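(* Let $X$ be an infinite dimensional $L^1$-predual space. If the norm of $X$ is strongly subdifferentiable (SSD) at every unit vector of $X$, then $X^\ast$ is (linearly) isometric to $\ell^1(\Gamma)$ for some infinite discrete set $\Gamma$.
   Context: An $L^1$-predual space is a Banach space $X$ (over the real or complex scalars) whose dual $X^\ast$ is linearly isometric to $L^1(\mu)$ (with the same scalar field) for some positive measure $\mu$. SSD: the norm of $X$ is strongly subdifferentiable at a unit vector $x$ if the limit $\lim_{t\to 0^+}\frac{\|x+ty\|-\|x\|}{t}$ exists uniformly for $y$ in the closed unit ball of $X$. *)

theory Defs
  imports "HOL-Analysis.Analysis"
begin

text \<open>
  Normed spaces over a scalar field 'k (used for the reals and the complex numbers) are
  types of class real_normed_vector with an additional scalar multiplication by 'k that
  extends the real one. Completeness is expressed by the class banach.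
\<close>

locale normed_space_over = vector_space smul
  for smul :: "'k::real_normed_field \<Rightarrow> 'a::real_normed_vector \<Rightarrow> 'a" +
  assumes norm_scale: "norm (smul c x) = norm c * norm x"
    and scale_of_real: "smul (of_real r) x = r *\<^sub>R x"

lemma normed_space_over_scaleR:
  "normed_space_over (scaleR :: real \<Rightarrow> 'a::real_normed_vector \<Rightarrow> 'a)"
  by unfold_locales (simp_all add: scaleR_add_left scaleR_add_right)

lemma normed_space_over_mult:
  "normed_space_over ((*) :: 'k::real_normed_field \<Rightarrow> 'k \<Rightarrow> 'k)"
  by unfold_locales (simp_all add: distrib_left distrib_right norm_mult scaleR_conv_of_real mult.assoc)

definition infinite_dimensional :: "('k::field \<Rightarrow> 'a::ab_group_add \<Rightarrow> 'a) \<Rightarrow> bool" where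
  "infinite_dimensional smul \<longleftrightarrow> \<not> (\<exists>B. finite B \<and> module.span smul B = UNIV)"

text \<open>
  The dual, \<open>L\<^sup>1(\<mu>)\<close> and \<open>\<ell>\<^sup>1(\<Gamma>)\<close> are normed spaces with
  explicit carriers.
\<close>

record ('k, 'v) nspace =
  vecs :: "'v set"
  vadd :: "'v \<Rightarrow> 'v \<Rightarrow> 'v"
  vscale :: "'k \<Rightarrow> 'v \<Rightarrow> 'v"
  vnorm :: "'v \<Rightarrow> real"

definition linearly_isometric :: "('k, 'v) nspace \<Rightarrow> ('k, 'w) nspace \<Rightarrow> bool" where
  "linearly_isometric V W \<longleftrightarrow>
    (\<exists>T. bij_betw T (vecs V) (vecs W) \<and>
         (\<forall>u\<in>vecs V. \<forall>v\<in>vecs V. T (vadd V u v) = vadd W (T u) (T v)) \<and>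
         (\<forall>c. \<forall>v\<in>vecs V. T (vscale V c v) = vscale W c (T v)) \<and>
         (\<forall>v\<in>vecs V. vnorm W (T v) = vnorm V v))"

definition dual_space ::
    "('k::real_normed_field \<Rightarrow> 'a::real_normed_vector \<Rightarrow> 'a) \<Rightarrow> ('k, 'a \<Rightarrow> 'k) nspace" where
  "dual_space smul =
    \<lparr>vecs = {f. Vector_Spaces.linear smul (*) f \<and> (\<exists>K. \<forall>x. norm (f x) \<le> norm x * K)},
     vadd = (\<lambda>f g x. f x + g x),
     vscale = (\<lambda>c f x. c * f x),
     vnorm = onorm\<rparr>"

text \<open>The elements of \<open>L\<^sup>1(\<mu>)\<close> are the classes of integrable functions modulo
  equality almost everywhere.\<close>

definition L1_class ::
    "'m measure \<Rightarrow> ('m \<Rightarrow> 'k::{real_normed_field,banach,second_countable_topology})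
      \<Rightarrow> ('m \<Rightarrow> 'k) set" where
  "L1_class M f = {g. integrable M g \<and> (AE x in M. g x = f x)}"

definition L1_space ::
    "'m measure \<Rightarrow>
      ('k::{real_normed_field,banach,second_countable_topology}, ('m \<Rightarrow> 'k) set) nspace" where
  "L1_space M =
    \<lparr>vecs = L1_class M ` {f. integrable M f},
     vadd = (\<lambda>A B. {h. integrable M h \<and> (\<exists>f\<in>A. \<exists>g\<in>B. AE x in M. h x = f x + g x)}),
     vscale = (\<lambda>c A. {h. integrable M h \<and> (\<exists>f\<in>A. AE x in M. h x = c * f x)}),
     vnorm = (\<lambda>A. THE r. \<exists>f\<in>A. r = (\<integral>x. norm (f x) \<partial>M))\<rparr>"

lemma L1_class_self: "integrable M f \<Longrightarrow> f \<in> L1_class M f"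
  by (simp add: L1_class_def)

lemma vadd_L1_class:
  assumes "integrable M f" "integrable M g"
  shows "vadd (L1_space M) (L1_class M f) (L1_class M g) = L1_class M (\<lambda>x. f x + g x)"
proof (intro set_eqI iffI)
  fix h assume "h \<in> vadd (L1_space M) (L1_class M f) (L1_class M g)"
  then obtain f' g' where h: "integrable M h" "AE x in M. f' x = f x" "AE x in M. g' x = g x"
      "AE x in M. h x = f' x + g' x"
    by (auto simp: L1_space_def L1_class_def)
  from h(2-4) have "AE x in M. h x = f x + g x"
    by eventually_elim simp
  with h(1) show "h \<in> L1_class M (\<lambda>x. f x + g x)"
    by (simp add: L1_class_def)
next
  fix h assume "h \<in> L1_class M (\<lambda>x. f x + g x)"
  then have "integrable M h" "AE x in M. h x = f x + g x"
    by (simp_all add: L1_class_def)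
  then show "h \<in> vadd (L1_space M) (L1_class M f) (L1_class M g)"
    using L1_class_self[OF assms(1)] L1_class_self[OF assms(2)]
    unfolding L1_space_def nspace.simps by blast
qed

lemma vscale_L1_class:
  assumes "integrable M f"
  shows "vscale (L1_space M) c (L1_class M f) = L1_class M (\<lambda>x. c * f x)"
proof (intro set_eqI iffI)
  fix h assume "h \<in> vscale (L1_space M) c (L1_class M f)"
  then obtain f' where h: "integrable M h" "AE x in M. f' x = f x" "AE x in M. h x = c * f' x"
    by (auto simp: L1_space_def L1_class_def)
  from h(2-3) have "AE x in M. h x = c * f x"
    by eventually_elim simp
  with h(1) show "h \<in> L1_class M (\<lambda>x. c * f x)"
    by (simp add: L1_class_def)
next
  fix h assume "h \<in> L1_class M (\<lambda>x. c * f x)"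
  then have "integrable M h" "AE x in M. h x = c * f x"
    by (simp_all add: L1_class_def)
  then show "h \<in> vscale (L1_space M) c (L1_class M f)"
    using L1_class_self[OF assms]
    unfolding L1_space_def nspace.simps by blast
qed

lemma vnorm_L1_class:
  assumes "integrable M f"
  shows "vnorm (L1_space M) (L1_class M f) = (\<integral>x. norm (f x) \<partial>M)"
proof -
  have eq: "(\<integral>x. norm (g x) \<partial>M) = (\<integral>x. norm (f x) \<partial>M)" if "g \<in> L1_class M f" for g
  proof (rule integral_cong_AE)
    show "AE x in M. norm (g x) = norm (f x)"
      using that unfolding L1_class_def by (auto elim: eventually_mono)
  qed (use that assms in \<open>auto simp: L1_class_def intro: borel_measurable_integrable\<close>)
  show ?thesis
    unfolding L1_space_def nspace.simps
    by (rule the_equality) (use L1_class_self[OF assms] eq in blast)+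
qed

text \<open>Elements of \<open>\<ell>\<^sup>1(\<Gamma>)\<close> are extended by 0 outside \<open>\<Gamma>\<close>, so
  that each has exactly one representing function. If the dual of a space of type 'a is linearly
  isometric to some \<open>\<ell>\<^sup>1(\<Gamma>)\<close>, the unit vectors embed \<open>\<Gamma>\<close> into the
  dual; so \<open>\<Gamma>\<close> may be sought, without loss of generality, among the sets of functions
  from 'a to the scalars.\<close>

definition ell1_space :: "'i set \<Rightarrow> ('k::real_normed_field, 'i \<Rightarrow> 'k) nspace" where
  "ell1_space \<Gamma> =
    \<lparr>vecs = {a. (\<forall>i. i \<notin> \<Gamma> \<longrightarrow> a i = 0) \<and> (\<lambda>i. norm (a i)) summable_on \<Gamma>},
     vadd = (\<lambda>a b i. a i + b i),
     vscale = (\<lambda>c a i. c * a i),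
     vnorm = (\<lambda>a. \<Sum>\<^sub>\<infinity>i\<in>\<Gamma>. norm (a i))\<rparr>"

definition L1_predual ::
    "('k::{real_normed_field,banach,second_countable_topology} \<Rightarrow> 'a::banach \<Rightarrow> 'a)
      \<Rightarrow> 'm measure \<Rightarrow> bool" where
  "L1_predual smul M \<longleftrightarrow>
    normed_space_over smul \<and> linearly_isometric (dual_space smul) (L1_space M)"

definition SSD_at :: "'a::real_normed_vector \<Rightarrow> bool" where
  "SSD_at x \<longleftrightarrow>
    (\<exists>L. uniform_limit (cball 0 1) (\<lambda>t y. (norm (x + t *\<^sub>R y) - norm x) / t) L (at_right 0))"

end

theory Submission
  imports Defs
begin

text \<open>
  Write \<open>X\<^sup>* = L\<^sup>1(\<mu>)\<close> and suppose that some set \<open>A\<close> of finite positive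
  measure contains no atom. At a unit vector \<open>x\<close>, the functionals supported in \<open>A\<close>
  that attain their norm at \<open>x\<close> are the nonnegative multiples \<open>w u\<close> of one function
  \<open>u\<close> with values of modulus 0 or 1. Split the support of \<open>u\<close> into two
  pieces, choose \<open>y\<close> in the unit ball at which \<open>u\<close> is almost norming on the first piece and
  \<open>-u\<close> on the second, and apply the Bishop-Phelps-Bollobas theorem to \<open>x + e y\<close>. By SSD at
  \<open>x\<close>, functionals attaining their norm at the resulting \<open>x'\<close> near \<open>x\<close> are close to such
  multiples of \<open>u\<close>, so the support of \<open>u'\<close> is smaller than that of \<open>u\<close> by a fixed
  factor. Iterating, one finds a limit point \<open>x\<close> at which SSD produces a functional
  concentrated on sets of arbitrarily small measure, which is absurd.

  Hence every set of finite positive measure contains an atom. The normalised indicators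
  of the atoms then form a family \<open>\<Gamma>\<close> in \<open>X\<^sup>*\<close> isometrically equivalent to the unit
  vector basis of \<open>\<ell>\<^sup>1(\<Gamma>)\<close>, and it spans because an integrable function whose
  integral over every atom vanishes is zero. If \<open>\<Gamma>\<close> were finite, \<open>X\<close> would be
  finite dimensional.
\<close>

section \<open>Norming functionals\<close>

text \<open>The phase \<open>u\<close> is unique because functionals attaining their norm at the
  same nonzero point add without cancellation almost everywhere. The support shrinks because the new
  functional must see \<open>y\<close> with at least 3/4 of its norm, while no part of
  \<open>u\<close> is seen with more than about half of the measure of its support. SSD is uniform
  over directions but not over points, so the modulus at each point of the iteration is fixed before
  the length of the next step is chosen. At the end SSD works both ways: at the limit point it turns
  functionals from the approximating points into one that attains its norm there, and at the
  approximating points it places this functional near functions with tiny support. The measure is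
  arbitrary and the family of atoms may be uncountable. Hence atoms are handled through finite
  subfamilies, and a nonzero function is examined on the sets where its norm exceeds a positive
  bound, which have finite measure.\<close>

text \<open>Zorn's lemma gives a minimal sublinear function below \<open>p\<close>, and minimality
  forces linearity.\<close>

lemma hahn_banach_sublinear:
  fixes p :: "'a::real_vector \<Rightarrow> real"
  assumes p_add: "\<And>x y. p (x + y) \<le> p x + p y"
    and p_scale: "\<And>c x. c > 0 \<Longrightarrow> p (c *\<^sub>R x) = c * p x"
  shows "\<exists>f. linear f \<and> (\<forall>x. f x \<le> p x)"
proof -
  define sublin :: "('a \<Rightarrow> real) \<Rightarrow> bool" where
    "sublin q \<longleftrightarrow> (\<forall>x y. q (x + y) \<le> q x + q y) \<and> (\<forall>c x. c > 0 \<longrightarrow> q (c *\<^sub>R x) = c * q x)" for q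
  have sublinI: "sublin q"
    if "\<And>x y. q (x + y) \<le> q x + q y" "\<And>c x. c > 0 \<Longrightarrow> q (c *\<^sub>R x) \<le> c * q x" for q
  proof -
    have "c * q x \<le> q (c *\<^sub>R x)" if "c > 0" for c x
    proof -
      have "q ((1/c) *\<^sub>R (c *\<^sub>R x)) \<le> (1/c) * q (c *\<^sub>R x)"
        using \<open>c > 0\<close> by (intro \<open>\<And>c x. c > 0 \<Longrightarrow> q (c *\<^sub>R x) \<le> c * q x\<close>) auto
      with \<open>c > 0\<close> show ?thesis by (simp add: field_simps)
    qed
    with that show ?thesis unfolding sublin_def by (meson order_antisym)
  qed
  have sub_zero: "q 0 = 0" if "sublin q" for q
  proof -
    have "q (2 *\<^sub>R 0) = 2 * q 0" using that unfolding sublin_def by (metis zero_less_numeral)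
    then show ?thesis by simp
  qed
  have sub_neg: "- q (- x) \<le> q x" if "sublin q" for q x
  proof -
    have "q (x + - x) \<le> q x + q (- x)" using that unfolding sublin_def by blast
    then show ?thesis using sub_zero[OF that] by simp
  qed
  define Q where "Q = {q. sublin q \<and> (\<forall>x. q x \<le> p x)}"
  \<comment> \<open>The order is reversed, so a maximal element for \<open>P\<close> is pointwise
    minimal.\<close>
  define P where "P = (\<lambda>a b :: 'a \<Rightarrow> real. b \<le> a)"
  have "\<exists>m\<in>Q. \<forall>a\<in>Q. P m a \<longrightarrow> a = m"
  proof (rule predicate_Zorn)
    show "partial_order_on Q (relation_of P Q)"
      unfolding P_def partial_order_on_def preorder_on_def refl_on_def trans_def antisym_def relation_of_def
      by auto
  next
    fix C assume C: "C \<in> Chains (relation_of P Q)"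
    show "\<exists>u\<in>Q. \<forall>a\<in>C. P a u"
    proof (cases "C = {}")
      case True
      have "p \<in> Q" using p_add p_scale by (auto simp: Q_def sublin_def)
      with True show ?thesis by auto
    next
      case False
      have CQ: "q \<in> Q" if "q \<in> C" for q
        using C that by (auto simp: Chains_def relation_of_def)
      have Csub: "sublin q" if "q \<in> C" for q using CQ[OF that] by (simp add: Q_def)
      have lin: "q1 \<le> q2 \<or> q2 \<le> q1" if "q1 \<in> C" "q2 \<in> C" for q1 q2
        using C that by (auto simp: Chains_def relation_of_def P_def)
      define u where "u x = (INF q\<in>C. q x)" for x
      have bdd: "bdd_below ((\<lambda>q. q x) ` C)" for x
      proof (rule bdd_belowI2)
        fix q assume "q \<in> C"
        then have "- q (- x) \<le> q x" "q (- x) \<le> p (- x)"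
          using sub_neg[OF Csub, of q x] CQ[of q] by (auto simp: Q_def)
        then show "- p (- x) \<le> q x" by linarith
      qed
      have u_le: "u x \<le> q x" if "q \<in> C" for q x
        unfolding u_def using that bdd by (intro cINF_lower)
      have u_ge: "c \<le> u x" if "\<And>q. q \<in> C \<Longrightarrow> c \<le> q x" for c x
        unfolding u_def using that False by (intro cINF_greatest)
      have "sublin u"
      proof (rule sublinI)
        fix x y
        have "u (x + y) \<le> q1 x + q2 y" if q: "q1 \<in> C" "q2 \<in> C" for q1 q2
        proof -
          obtain q where q': "q \<in> C" "q \<le> q1" "q \<le> q2" using lin[OF q] q by blast
          have "u (x + y) \<le> q (x + y)" by (rule u_le[OF q'(1)])
          also have "\<dots> \<le> q x + q y" using Csub[OF q'(1)] by (simp add: sublin_def)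
          also have "\<dots> \<le> q1 x + q2 y" using q' by (simp add: le_fun_def add_mono)
          finally show ?thesis .
        qed
        then have "u (x + y) - q2 y \<le> u x" if "q2 \<in> C" for q2
          using that by (intro u_ge) (simp add: algebra_simps)
        then have "u (x + y) - u x \<le> u y"
          by (intro u_ge) (simp add: algebra_simps)
        then show "u (x + y) \<le> u x + u y" by simp
      next
        fix c :: real and x assume c: "c > 0"
        have "u (c *\<^sub>R x) / c \<le> u x"
        proof (rule u_ge)
          fix q assume q: "q \<in> C"
          have "u (c *\<^sub>R x) \<le> q (c *\<^sub>R x)" by (rule u_le[OF q])
          also have "\<dots> = c * q x" using Csub[OF q] c by (simp add: sublin_def)
          finally show "u (c *\<^sub>R x) / c \<le> q x" using c by (simp add: field_simps)
        qed
        then show "u (c *\<^sub>R x) \<le> c * u x" using c by (simp add: field_simps)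
      qed
      moreover have "u x \<le> p x" for x
      proof -
        obtain q where "q \<in> C" using False by blast
        then have "u x \<le> q x" "q x \<le> p x" using u_le[of q x] CQ[of q] by (auto simp: Q_def)
        then show ?thesis by linarith
      qed
      ultimately have "u \<in> Q" by (simp add: Q_def)
      then show ?thesis using u_le by (auto simp: P_def le_fun_def)
    qed
  qed
  then obtain q where qQ: "q \<in> Q" and qmin: "\<And>a. a \<in> Q \<Longrightarrow> a \<le> q \<Longrightarrow> a = q"
    unfolding P_def by blast
  have q: "sublin q" using qQ by (simp add: Q_def)
  have q_add: "q (x + y) \<le> q x + q y" for x y using q by (simp add: sublin_def)
  have q_scale: "c > 0 \<Longrightarrow> q (c *\<^sub>R x) = c * q x" for c x using q by (simp add: sublin_def)
  have q_scale0: "c \<ge> 0 \<Longrightarrow> q (c *\<^sub>R x) = c * q x" for c x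
    using q_scale[of c x] sub_zero[OF q] by (cases "c = 0") auto
  have q_neg: "q (- y) = - q y" for y
  proof -
    \<comment> \<open>\<open>k\<close> is sublinear and below \<open>q\<close>, so minimality gives
      \<open>k = q\<close>. The value at \<open>- y\<close>, estimated with \<open>t = 1\<close>,
      then yields \<open>q (- y) \<le> - q y\<close>.\<close>
    define k where "k x = (INF t\<in>{0..}. q (x + t *\<^sub>R y) - t * q y)" for x
    have low: "- q (- x) \<le> q (x + t *\<^sub>R y) - t * q y" if "t \<ge> 0" for x t
      using q_add[of "x + t *\<^sub>R y" "- x"] q_scale0[OF that, of y] by simp
    have bdd: "bdd_below ((\<lambda>t. q (x + t *\<^sub>R y) - t * q y) ` {0..})" for x
      using low by (intro bdd_belowI2[where m="- q (- x)"]) auto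
    have k_le: "k x \<le> q (x + t *\<^sub>R y) - t * q y" if "t \<ge> 0" for x t
      unfolding k_def using that by (intro cINF_lower bdd) auto
    have k_ge: "c \<le> k x" if "\<And>t. t \<ge> 0 \<Longrightarrow> c \<le> q (x + t *\<^sub>R y) - t * q y" for c x
      unfolding k_def using that by (intro cINF_greatest) auto
    have "sublin k"
    proof (rule sublinI)
      fix x z
      have *: "k (x + z) \<le> (q (x + t *\<^sub>R y) - t * q y) + (q (z + s *\<^sub>R y) - s * q y)"
        if "t \<ge> 0" "s \<ge> 0" for t s
      proof -
        have "k (x + z) \<le> q ((x + z) + (t + s) *\<^sub>R y) - (t + s) * q y"
          using that by (intro k_le) auto
        also have "(x + z) + (t + s) *\<^sub>R y = (x + t *\<^sub>R y) + (z + s *\<^sub>R y)"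
          by (simp add: algebra_simps)
        also have "q \<dots> \<le> q (x + t *\<^sub>R y) + q (z + s *\<^sub>R y)" by (rule q_add)
        finally show ?thesis by (simp add: algebra_simps)
      qed
      have "k (x + z) - (q (z + s *\<^sub>R y) - s * q y) \<le> k x" if "s \<ge> 0" for s
        using *[OF _ that] by (intro k_ge) (smt (verit))
      then have "k (x + z) - k x \<le> k z"
        by (intro k_ge) (smt (verit))
      then show "k (x + z) \<le> k x + k z" by simp
    next
      fix c :: real and x assume c: "c > 0"
      have "k (c *\<^sub>R x) / c \<le> k x"
      proof (rule k_ge)
        fix t :: real assume t: "t \<ge> 0"
        have "k (c *\<^sub>R x) \<le> q (c *\<^sub>R x + (c * t) *\<^sub>R y) - (c * t) * q y"
          using c t by (intro k_le) auto
        also have "c *\<^sub>R x + (c * t) *\<^sub>R y = c *\<^sub>R (x + t *\<^sub>R y)" by (simp add: algebra_simps)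
        also have "q \<dots> = c * q (x + t *\<^sub>R y)" by (rule q_scale[OF c])
        finally show "k (c *\<^sub>R x) / c \<le> q (x + t *\<^sub>R y) - t * q y"
          using c by (simp add: field_simps)
      qed
      then show "k (c *\<^sub>R x) \<le> c * k x" using c by (simp add: field_simps)
    qed
    moreover have kq: "k x \<le> q x" for x using k_le[of 0 x] by simp
    moreover have "k x \<le> p x" for x
      using order_trans[OF kq[of x]] qQ by (auto simp: Q_def)
    ultimately have "k = q" by (intro qmin) (auto simp: Q_def le_fun_def)
    then have "q (- y) \<le> - q y" using k_le[of 1 "- y"] sub_zero[OF q] by simp
    then show ?thesis using sub_neg[OF q, of y] by simp
  qed
  have "linear q"
  proof (rule linearI)
    show "q (x + y) = q x + q y" for x y
      using q_add[of x y] q_add[of "- x" "- y"] q_neg[of "x + y"] q_neg[of x] q_neg[of y]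
      by (simp add: algebra_simps)
    show "q (c *\<^sub>R x) = c *\<^sub>R q x" for c x
    proof (cases "c \<ge> 0")
      case True then show ?thesis using q_scale0 by simp
    next
      case False
      then have "q ((- c) *\<^sub>R x) = (- c) * q x" by (intro q_scale0) auto
      then show ?thesis using q_neg[of "c *\<^sub>R x"] by simp
    qed
  qed
  then show ?thesis using qQ by (auto simp: Q_def)
qed

text \<open>After rescaling \<open>w\<close>, the hypothesis puts \<open>f\<close> below the sum of
  the one-sided derivative of the norm at \<open>x\<close> and \<open>e * norm\<close>. A sandwich
  argument then finds a linear \<open>g\<close> below that derivative and within \<open>e\<close> of
  \<open>f\<close>.\<close>

lemma norming_functional_near:
  fixes x :: "'a::real_normed_vector"
  assumes f: "linear f" and e: "e \<ge> 0"
    and le: "\<And>w. f w \<le> norm (x + w) - norm x + e * norm w"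
  shows "\<exists>g. linear g \<and> g x = norm x \<and> (\<forall>w. g w \<le> norm w) \<and> (\<forall>w. f w - g w \<le> e * norm w)"
proof -
  \<comment> \<open>With \<open>s = 1 / t\<close> the first two terms are the quotient
    \<open>(norm (x + t *\<^sub>R z) - norm x) / t\<close>, whose infimum is the derivative in
    direction \<open>z\<close>. So \<open>p\<close> is the infimal convolution of this derivative
    with \<open>f + e * norm\<close>: taking \<open>z = w\<close> puts \<open>g\<close> below the
    former, taking \<open>z = 0\<close> below the latter.\<close>
  define F where "F w s z = norm (s *\<^sub>R x + z) - s * norm x + f (w - z) + e * norm (w - z)" for w s z
  define p where "p w = (INF (s, z)\<in>{0<..} \<times> UNIV. F w s z)" for w
  have f_diff: "f (a - b) = f a - f b" for a b using f by (rule linear_diff)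
  have f_add: "f (a + b) = f a + f b" for a b using f by (rule linear_add)
  have f_scale: "f (c *\<^sub>R a) = c * f a" for a c using linear_scale[OF f] by simp
  have low: "f w - e * norm w \<le> F w s z" if s: "s > 0" for w s z
  proof -
    have "f ((1/s) *\<^sub>R z) \<le> norm (x + (1/s) *\<^sub>R z) - norm x + e * norm ((1/s) *\<^sub>R z)" by (rule le)
    then have "s * f ((1/s) *\<^sub>R z) \<le> s * (norm (x + (1/s) *\<^sub>R z) - norm x + e * norm ((1/s) *\<^sub>R z))"
      using s by (intro mult_left_mono) auto
    also have "\<dots> = norm (s *\<^sub>R (x + (1/s) *\<^sub>R z)) - s * norm x + e * norm z"
      using s by (simp add: right_diff_distrib distrib_left)
    also have "s *\<^sub>R (x + (1/s) *\<^sub>R z) = s *\<^sub>R x + z" using s by (simp add: algebra_simps)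
    finally have "f z \<le> norm (s *\<^sub>R x + z) - s * norm x + e * norm z"
      using s by (simp add: f_scale)
    moreover have "e * norm z \<le> e * norm (w - z) + e * norm w"
      using e norm_triangle_ineq4[of w "w - z"]
      by (metis add.commute diff_diff_eq2 add_diff_cancel_left' distrib_left mult_left_mono)
    ultimately show ?thesis by (simp add: F_def f_diff)
  qed
  have bdd: "bdd_below ((\<lambda>(s, z). F w s z) ` ({0<..} \<times> UNIV))" for w
    using low by (intro bdd_belowI2[where m="f w - e * norm w"]) auto
  have p_le: "p w \<le> F w s z" if "s > 0" for w s z
    unfolding p_def using cINF_lower[OF bdd, of "(s, z)"] that by auto
  have p_ge: "c \<le> p w" if "\<And>s z. s > 0 \<Longrightarrow> c \<le> F w s z" for c w
    unfolding p_def using that by (intro cINF_greatest) auto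
  have "p (v + w) \<le> p v + p w" for v w
  proof -
    have *: "p (v + w) \<le> F v s z + F w s' z'" if "s > 0" "s' > 0" for s s' z z'
    proof -
      have "p (v + w) \<le> F (v + w) (s + s') (z + z')" using that by (intro p_le) auto
      also have "\<dots> \<le> F v s z + F w s' z'"
      proof -
        have "norm ((s + s') *\<^sub>R x + (z + z')) \<le> norm (s *\<^sub>R x + z) + norm (s' *\<^sub>R x + z')"
          using norm_triangle_ineq[of "s *\<^sub>R x + z" "s' *\<^sub>R x + z'"] by (simp add: algebra_simps)
        moreover have "norm (v + w - (z + z')) \<le> norm (v - z) + norm (w - z')"
          using norm_triangle_ineq[of "v - z" "w - z'"] by (simp add: algebra_simps)
        then have "e * norm (v + w - (z + z')) \<le> e * norm (v - z) + e * norm (w - z')"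
          using e by (metis distrib_left mult_left_mono)
        ultimately show ?thesis unfolding F_def by (simp add: f_diff f_add algebra_simps)
      qed
      finally show ?thesis .
    qed
    have "p (v + w) - F w s' z' \<le> p v" if "s' > 0" for s' z'
      using *[OF _ that] by (intro p_ge) (smt (verit))
    then have "p (v + w) - p v \<le> p w"
      by (intro p_ge) (smt (verit))
    then show ?thesis by simp
  qed
  moreover have p_scale1: "p (c *\<^sub>R w) \<le> c * p w" if c: "c > 0" for c w
  proof -
    have "p (c *\<^sub>R w) / c \<le> p w"
    proof (rule p_ge)
      fix s :: real and z assume s: "s > 0"
      have "p (c *\<^sub>R w) \<le> F (c *\<^sub>R w) (c * s) (c *\<^sub>R z)" using c s by (intro p_le) auto
      also have "\<dots> = norm (c *\<^sub>R (s *\<^sub>R x + z)) - c * (s * norm x) + f (c *\<^sub>R (w - z)) + e * norm (c *\<^sub>R (w - z))"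
        unfolding F_def by (simp only: scaleR_right_distrib scaleR_right_diff_distrib scaleR_scaleR mult.assoc)
      also have "\<dots> = c * F w s z"
        using c unfolding norm_scaleR f_scale F_def by (simp add: algebra_simps)
      finally show "p (c *\<^sub>R w) / c \<le> F w s z" using c by (simp add: field_simps)
    qed
    then show ?thesis using c by (simp add: field_simps)
  qed
  moreover have "c * p w \<le> p (c *\<^sub>R w)" if c: "c > 0" for c w
    using p_scale1[of "1/c" "c *\<^sub>R w"] c by (simp add: field_simps)
  ultimately have "\<exists>g. linear g \<and> (\<forall>w. g w \<le> p w)"
    by (intro hahn_banach_sublinear) (auto intro: order_antisym)
  then obtain g where g: "linear g" "\<And>w. g w \<le> p w" by blast
  have g1: "g w \<le> norm (x + w) - norm x" for w
    using g(2)[of w] p_le[of 1 w w] linear_0[OF f] by (simp add: F_def)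
  have g2: "g w \<le> f w + e * norm w" for w
    using g(2)[of w] p_le[of 1 w 0] by (simp add: F_def)
  have "g w \<le> norm w" for w using g1[of w] norm_triangle_ineq[of x w] by simp
  moreover have "g x = norm x"
    using g1[of "- x"] \<open>g x \<le> norm x\<close> linear_neg[OF g(1), of x] by simp
  moreover have "f w - g w \<le> e * norm w" for w
    using g2[of "- w"] linear_neg[OF g(1), of w] linear_neg[OF f, of w] by simp
  ultimately show ?thesis using g(1) by blast
qed

section \<open>Ekeland's variational principle and perturbation of norming functionals\<close>

text \<open>The relation \<open>w \<in> S z\<close> is transitive. Each step picks a point of
  \<open>S (X n)\<close> that minimises \<open>h\<close> there up to \<open>(1/2) ^ n\<close>, which
  bounds the diameter of the next set. The nested closed sets meet in one point \<open>a\<close>,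
  and \<open>S a\<close> contains no other point.\<close>

lemma ekeland:
  fixes h :: "'a::complete_space \<Rightarrow> real"
  assumes cont: "continuous_on UNIV h" and pos: "\<And>z. 0 \<le> h z" and l: "l > 0"
  shows "\<exists>x. h x + l * dist x x0 \<le> h x0 \<and> (\<forall>z. h x \<le> h z + l * dist z x)"
proof -
  define S where "S z = {w. h w + l * dist w z \<le> h z}" for z
  have S_self: "z \<in> S z" for z by (simp add: S_def)
  have S_trans: "S w \<subseteq> S z" if "w \<in> S z" for w z
  proof
    fix v assume "v \<in> S w"
    moreover have "l * dist v z \<le> l * dist v w + l * dist w z"
      using l dist_triangle[of v z w] by (metis distrib_left less_imp_le mult_left_mono)
    ultimately show "v \<in> S z" using that by (simp add: S_def)
  qed
  have S_closed: "closed (S z)" for z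
    unfolding S_def
    by (intro closed_Collect_le continuous_intros continuous_on_compose2[OF cont]) auto
  have "\<exists>w\<in>S z. \<forall>v\<in>S z. h w \<le> h v + (1/2) ^ n" for z and n :: nat
  proof -
    have bdd: "bdd_below (h ` S z)" using pos by (intro bdd_belowI2) auto
    have "\<exists>y\<in>h ` S z. y < Inf (h ` S z) + (1/2) ^ n"
      using S_self[of z] by (intro cInf_lessD) auto
    then obtain w where "w \<in> S z" "h w < Inf (h ` S z) + (1/2) ^ n" by blast
    moreover have "Inf (h ` S z) \<le> h v" if "v \<in> S z" for v using that bdd by (intro cINF_lower)
    ultimately show ?thesis by force
  qed
  then obtain nx where nx: "\<And>z n. nx z n \<in> S z" "\<And>z n v. v \<in> S z \<Longrightarrow> h (nx z n) \<le> h v + (1/2) ^ n"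
    by metis
  define X where "X = rec_nat x0 (\<lambda>n z. nx z n)"
  have X0: "X 0 = x0" and XS: "X (Suc n) = nx (X n) n" for n by (simp_all add: X_def)
  have step: "S (X (Suc n)) \<subseteq> S (X n)" for n using nx(1) XS S_trans by metis
  have anti: "S (X n) \<subseteq> S (X m)" if "m \<le> n" for m n
    using lift_Suc_antimono_le[of "\<lambda>n. S (X n)", OF step that] .
  have small: "l * dist w (X (Suc n)) \<le> (1/2) ^ n" if "w \<in> S (X (Suc n))" for w n
  proof -
    have "h (X (Suc n)) \<le> h w + (1/2) ^ n" using nx(2)[of w "X n" n] step that XS by auto
    with that show ?thesis by (simp add: S_def)
  qed
  have "\<exists>a. \<Inter>(range (\<lambda>n. S (X n))) = {a}"
  proof (rule decreasing_closed_nest_sing)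
    fix e :: real assume "e > 0"
    then obtain n where n: "(1/2::real) ^ n < l * e / 2"
      using l real_arch_pow_inv[of "l * e / 2" "1/2"] by auto
    have "dist v w < e" if "v \<in> S (X (Suc n))" "w \<in> S (X (Suc n))" for v w
    proof -
      have "l * dist v w \<le> l * dist v (X (Suc n)) + l * dist w (X (Suc n))"
        using l dist_triangle2[of v w "X (Suc n)"] by (metis distrib_left less_imp_le mult_left_mono)
      also have "\<dots> < l * e" using small[OF that(1)] small[OF that(2)] n by simp
      finally show ?thesis using l by simp
    qed
    then show "\<exists>n. \<forall>x\<in>S (X n). \<forall>y\<in>S (X n). dist x y < e" by blast
  qed (use S_closed S_self anti in \<open>auto, blast?\<close>)
  then obtain a where a: "\<Inter>(range (\<lambda>n. S (X n))) = {a}" by blast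
  then have aS: "a \<in> S (X n)" for n by blast
  have "h a \<le> h z + l * dist z a" for z
  proof (rule ccontr)
    assume neg: "\<not> ?thesis"
    then have "z \<in> S a" by (simp add: S_def)
    then have "z \<in> S (X n)" for n using S_trans[OF aS] by blast
    then have "z = a" using a by blast
    with neg show False by simp
  qed
  moreover have "h a + l * dist a x0 \<le> h x0" using aS[of 0] by (simp add: S_def X0)
  ultimately show ?thesis by blast
qed

text \<open>Ekeland's principle is applied to \<open>norm z - f z\<close>, which is nonnegative and
  at most \<open>d\<close> at \<open>x0\<close>. The resulting inequality at \<open>x\<close> is
  precisely the hypothesis of \<open>norming_functional_near\<close> with
  \<open>e = l\<close>.\<close>

lemma bishop_phelps_bollobas:
  fixes x0 :: "'a::banach"
  assumes f: "linear f" "\<And>w. f w \<le> norm w" and x0: "norm x0 - d \<le> f x0" and l: "l > 0"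
  shows "\<exists>x g. linear g \<and> g x = norm x \<and> (\<forall>w. g w \<le> norm w) \<and> (\<forall>w. f w - g w \<le> l * norm w)
    \<and> l * norm (x - x0) \<le> d"
proof -
  interpret f: linear f by (rule f(1))
  have "bounded_linear f"
  proof (rule bounded_linear_intro[where K = 1])
    show "norm (f w) \<le> norm w * 1" for w using f(2)[of w] f(2)[of "- w"] f.neg by simp
  qed (simp_all add: f.add f.scale)
  then have "continuous_on UNIV (\<lambda>z. norm z - f z)"
    by (intro continuous_intros linear_continuous_on)
  from ekeland[OF this _ l, of x0] f(2) obtain x
    where x: "norm x - f x + l * dist x x0 \<le> norm x0 - f x0"
      "\<And>z. norm x - f x \<le> norm z - f z + l * dist z x"
    by auto
  have "f w \<le> norm (x + w) - norm x + l * norm w" for w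
    using x(2)[of "x + w"] by (simp add: f.add dist_norm)
  from norming_functional_near[OF f(1) _ this] l obtain g where
    "linear g" "g x = norm x" "\<forall>w. g w \<le> norm w" "\<forall>w. f w - g w \<le> l * norm w" by auto
  moreover have "l * norm (x - x0) \<le> d"
    using x(1) f(2)[of x] x0 by (simp add: dist_norm)
  ultimately show ?thesis by blast
qed

text \<open>By convexity the difference quotients of the norm decrease with the step size. Hence one
  step \<open>t\<close> in the range of uniformity bounds \<open>f\<close> against the quotients for
  all step sizes, as \<open>norming_functional_near\<close> requires.\<close>

lemma SSD_at_norming_functional_near:
  fixes x :: "'a::real_normed_vector"
  assumes ssd: "SSD_at x" and x: "norm x = 1" and e: "e > 0"
  shows "\<exists>d>0. \<forall>f. linear f \<longrightarrow> (\<forall>w. f w \<le> norm w) \<longrightarrow> 1 - d \<le> f x \<longrightarrow>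
    (\<exists>g. linear g \<and> g x = 1 \<and> (\<forall>w. g w \<le> norm w) \<and> (\<forall>w. f w - g w \<le> e * norm w))"
proof -
  define q where "q t y = (norm (x + t *\<^sub>R y) - norm x) / t" for t y
  obtain L where "uniform_limit (cball 0 1) q L (at_right 0)"
    using ssd unfolding SSD_at_def q_def[abs_def] by blast
  then have "\<forall>\<^sub>F t in at_right 0. \<forall>y\<in>cball 0 1. dist (q t y) (L y) < e/3"
    using e by (auto dest!: uniform_limitD[where e = "e/3"])
  then obtain b where b: "b > 0" "\<And>t y. \<lbrakk>0 < t; t < b; y \<in> cball 0 1\<rbrakk> \<Longrightarrow> dist (q t y) (L y) < e/3"
    unfolding eventually_at_right_field by auto
  define t where "t = b/2"
  have t: "0 < t" "t < b" using b by (auto simp: t_def)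
  have q_close: "q t y \<le> q s y + 2/3 * e" if s: "s > 0" and y: "norm y \<le> 1" for s y
  proof (cases "s < b")
    case True
    then show ?thesis using b(2)[OF s True, of y] b(2)[OF t, of y] y e
      unfolding dist_real_def by (simp add: abs_if split: if_splits)
  next
    case False
    then have "t \<le> s" using t by simp
    define c where "c = t/s"
    have c: "0 < c" "c \<le> 1" using s t \<open>t \<le> s\<close> by (auto simp: c_def)
    have "norm (x + t *\<^sub>R y) = norm ((1 - c) *\<^sub>R x + c *\<^sub>R (x + s *\<^sub>R y))"
      using s by (simp add: c_def algebra_simps)
    also have "\<dots> \<le> (1 - c) * norm x + c * norm (x + s *\<^sub>R y)"
      using c norm_triangle_ineq[of "(1 - c) *\<^sub>R x" "c *\<^sub>R (x + s *\<^sub>R y)"] by simp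
    finally have "norm (x + t *\<^sub>R y) - norm x \<le> c * (norm (x + s *\<^sub>R y) - norm x)"
      by (simp add: algebra_simps)
    then have "q t y \<le> q s y" using t s by (simp add: q_def c_def field_simps)
    then show ?thesis using e by simp
  qed
  \<comment> \<open>The bound for \<open>f\<close> at \<open>x + t *\<^sub>R y\<close> turns into
    one for \<open>f y\<close> after division by \<open>t\<close>, which magnifies the defect
    \<open>t * e/3\<close> to \<open>e/3\<close>. The remaining \<open>2/3 * e\<close> is spent by
    \<open>q_close\<close>.\<close>
  have main: "\<exists>g. linear g \<and> g x = 1 \<and> (\<forall>w. g w \<le> norm w) \<and> (\<forall>w. f w - g w \<le> e * norm w)"
    if f: "linear f" "\<forall>w. f w \<le> norm w" "1 - t * e/3 \<le> f x" for f
  proof -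
    interpret f: linear f by (rule f(1))
    have fs: "f (c *\<^sub>R a) = c * f a" for c a using f.scale by simp
    have "f w \<le> norm (x + w) - norm x + e * norm w" for w
    proof (cases "w = 0")
      case True then show ?thesis by (simp add: f.zero)
    next
      case False
      define s where "s = norm w"
      define y where "y = (1/s) *\<^sub>R w"
      have s: "s > 0" using False by (simp add: s_def)
      have w: "w = s *\<^sub>R y" and y: "norm y = 1" using False by (simp_all add: y_def s_def)
      have "f x + t * f y \<le> norm (x + t *\<^sub>R y)"
        using f(2)[rule_format, of "x + t *\<^sub>R y"] by (simp add: f.add fs)
      moreover have "t * q t y = norm (x + t *\<^sub>R y) - 1" using t x by (simp add: q_def)
      ultimately have "t * f y \<le> t * (q t y + e/3)" using f(3) by (simp add: distrib_left)
      then have "f y \<le> q t y + e/3" using t by simp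
      also have "\<dots> \<le> q s y + e" using q_close[OF s, of y] y by simp
      finally have "s * f y \<le> s * (q s y + e)" using s by simp
      moreover have "s * q s y = norm (x + w) - norm x" using s by (simp add: q_def w)
      moreover have "f w = s * f y" by (simp add: w fs)
      ultimately show ?thesis by (simp add: s_def algebra_simps)
    qed
    from norming_functional_near[OF f(1) _ this] e x show ?thesis by auto
  qed
  show ?thesis
    using main t e by (intro exI[of _ "t * e/3"]) auto
qed

section \<open>Spaces whose dual is an \<open>L\<^sup>1\<close> space\<close>

lemma AE_eq_of_integral_le:
  fixes f g :: "'m \<Rightarrow> real"
  assumes int: "integrable M f" "integrable M g" and le: "AE m in M. f m \<le> g m"
    and "(\<integral>m. g m \<partial>M) \<le> (\<integral>m. f m \<partial>M)"
  shows "AE m in M. f m = g m"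
proof -
  have int': "integrable M (\<lambda>m. g m - f m)" using int by simp
  have ge: "AE m in M. 0 \<le> g m - f m" using le by eventually_elim simp
  have "(\<integral>m. g m - f m \<partial>M) = 0"
    using assms integral_nonneg_AE[OF ge] by simp
  then have "AE m in M. g m - f m = 0"
    using integral_nonneg_eq_0_iff_AE[OF int' ge] by simp
  then show ?thesis by eventually_elim simp
qed

text \<open>\<open>r f x\<close> is the real part of the value at \<open>x\<close> of the functional
  corresponding to \<open>f\<close>. The scalars enter only as a Euclidean space.\<close>

locale L1_pairing =
  fixes M :: "'m measure" and r :: "('m \<Rightarrow> 'k::euclidean_space) \<Rightarrow> 'a::banach \<Rightarrow> real"
  assumes r_add: "\<lbrakk>integrable M f; integrable M g\<rbrakk> \<Longrightarrow> r (\<lambda>m. f m + g m) x = r f x + r g x"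
    and r_scaleR: "integrable M f \<Longrightarrow> r (\<lambda>m. c *\<^sub>R f m) x = c * r f x"
    and r_linear: "integrable M f \<Longrightarrow> linear (r f)"
    and r_bound: "integrable M f \<Longrightarrow> r f x \<le> (\<integral>m. norm (f m) \<partial>M) * norm x"
    and r_norming: "\<lbrakk>integrable M f; 0 \<le> K; \<And>y. r f y \<le> K * norm y\<rbrakk> \<Longrightarrow> (\<integral>m. norm (f m) \<partial>M) \<le> K"
    and r_surj: "\<lbrakk>linear l; \<And>y. l y \<le> norm y\<rbrakk> \<Longrightarrow> \<exists>f. integrable M f \<and> r f = l"
begin

abbreviation nrm :: "('m \<Rightarrow> 'k) \<Rightarrow> real" where "nrm f \<equiv> (\<integral>m. norm (f m) \<partial>M)"

lemma r_diff:
  assumes "integrable M f" "integrable M g"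
  shows "r (\<lambda>m. f m - g m) x = r f x - r g x"
proof -
  have "r (\<lambda>m. f m + (- 1) *\<^sub>R g m) x = r f x + (- 1) * r g x"
    using assms r_scaleR[of g "- 1" x] r_add[of f "\<lambda>m. (- 1) *\<^sub>R g m" x] by simp
  then show ?thesis by simp
qed

lemma r_minus: "integrable M f \<Longrightarrow> r f (- x) = - r f x"
  by (rule linear_neg[OF r_linear])

lemma r_abs_bound: "integrable M f \<Longrightarrow> \<bar>r f x\<bar> \<le> nrm f * norm x"
  using r_bound[of f x] r_bound[of f "- x"] by (simp add: r_minus)

lemma r_near:
  assumes "integrable M f" "integrable M g"
  shows "\<bar>r f x - r g x\<bar> \<le> nrm (\<lambda>m. f m - g m) * norm x"
  using r_abs_bound[of "\<lambda>m. f m - g m" x] assms by (simp add: r_diff)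

lemma r_add_point: "integrable M f \<Longrightarrow> r f (x + y) = r f x + r f y"
  by (rule linear_add[OF r_linear])

lemma r_diff_point: "integrable M f \<Longrightarrow> r f (x - y) = r f x - r f y"
  by (rule linear_diff[OF r_linear])

lemma r_scale_point: "integrable M f \<Longrightarrow> r f (c *\<^sub>R x) = c * r f x"
  using linear_scale[OF r_linear, of f c x] by simp

lemma r_almost_norming:
  assumes f: "integrable M f" and d: "d > 0"
  shows "\<exists>y. norm y \<le> 1 \<and> nrm f - d \<le> r f y"
proof (rule ccontr)
  assume "\<not> ?thesis"
  then have *: "r f y < nrm f - d" if "norm y \<le> 1" for y using that by force
  from *[of 0] linear_0[OF r_linear[OF f]] have pos: "0 < nrm f - d" by simp
  have "r f y \<le> (nrm f - d) * norm y" for y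
  proof (cases "y = 0")
    case True then show ?thesis using linear_0[OF r_linear[OF f]] by simp
  next
    case False
    then have "norm ((1 / norm y) *\<^sub>R y) \<le> 1" by simp
    from *[OF this] have "r f ((1 / norm y) *\<^sub>R y) \<le> nrm f - d" by linarith
    then show ?thesis using False by (simp add: r_scale_point f field_simps)
  qed
  from r_norming[OF f _ this] pos d show False by simp
qed

section \<open>The cone of functionals attaining their norm at a point\<close>

text \<open>The zero function is included, which makes this a cone. At \<open>x = 0\<close> it
  consists of all integrable functions, so statements about phases exclude that point.\<close>

definition attain :: "'a \<Rightarrow> ('m \<Rightarrow> 'k) set" where
  "attain x = {f. integrable M f \<and> r f x = nrm f * norm x}"

lemma attain_integrable: "f \<in> attain x \<Longrightarrow> integrable M f"
  by (simp add: attain_def)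

lemma attain_scale_point: "c > 0 \<Longrightarrow> attain (c *\<^sub>R x) = attain x"
  by (auto simp: attain_def r_scale_point)

lemma attain_scaleR: "f \<in> attain x \<Longrightarrow> c \<ge> 0 \<Longrightarrow> (\<lambda>m. c *\<^sub>R f m) \<in> attain x"
  by (simp add: attain_def r_scaleR)

lemma nrm_add_le:
  assumes "integrable M f" "integrable M g"
  shows "nrm (\<lambda>m. f m + g m) \<le> nrm f + nrm g"
proof -
  have "nrm (\<lambda>m. f m + g m) \<le> (\<integral>m. norm (f m) + norm (g m) \<partial>M)"
    using assms by (intro integral_mono) (auto intro: norm_triangle_ineq)
  then show ?thesis using assms by simp
qed

lemma attain_add:
  assumes "f \<in> attain x" "g \<in> attain x"
  shows "(\<lambda>m. f m + g m) \<in> attain x"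
proof -
  have i: "integrable M f" "integrable M g" using assms by (auto simp: attain_def)
  have "nrm (\<lambda>m. f m + g m) * norm x \<le> (nrm f + nrm g) * norm x"
    by (intro mult_right_mono nrm_add_le i) auto
  moreover have "r (\<lambda>m. f m + g m) x = (nrm f + nrm g) * norm x"
    using assms by (simp add: r_add i attain_def distrib_right)
  ultimately show ?thesis
    using r_bound[of "\<lambda>m. f m + g m" x] i by (simp add: attain_def)
qed

text \<open>The two attained bounds add up and leave no slack in the integrated triangle inequality.
  The pointwise equality is what gives the members of the cone a common phase.\<close>

lemma attain_add_norm:
  assumes "f \<in> attain x" "g \<in> attain x" "x \<noteq> 0"
  shows "AE m in M. norm (f m + g m) = norm (f m) + norm (g m)"
proof (rule AE_eq_of_integral_le)
  have i: "integrable M f" "integrable M g" using assms by (auto simp: attain_def)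
  then show "integrable M (\<lambda>m. norm (f m + g m))" "integrable M (\<lambda>m. norm (f m) + norm (g m))"
    by auto
  have "nrm (\<lambda>m. f m + g m) * norm x = (nrm f + nrm g) * norm x"
    using attain_add[OF assms(1,2)] assms(1,2) by (simp add: attain_def r_add i distrib_right)
  then show "(\<integral>m. norm (f m) + norm (g m) \<partial>M) \<le> nrm (\<lambda>m. f m + g m)"
    using i assms(3) by simp
qed (auto intro: norm_triangle_ineq)

text \<open>The cone is hereditary: when the norms add up, a sum can meet its bound only if each
  summand meets its own.\<close>

lemma attain_summand:
  assumes i: "integrable M f" "integrable M g" and fg: "(\<lambda>m. f m + g m) \<in> attain x"
    and n: "\<And>m. norm (f m + g m) = norm (f m) + norm (g m)"
  shows "f \<in> attain x"
proof -
  have "r f x + r g x = (nrm f + nrm g) * norm x"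
    using fg i n by (simp add: attain_def r_add)
  then show ?thesis
    using r_bound[OF i(1), of x] r_bound[OF i(2), of x] i by (simp add: attain_def distrib_right)
qed

lemma attain_lim:
  assumes fn: "\<And>n. fn n \<in> attain x" and f: "integrable M f"
    and lim: "(\<lambda>n. nrm (\<lambda>m. fn n m - f m)) \<longlonglongrightarrow> 0"
  shows "f \<in> attain x"
proof -
  have i: "integrable M (fn n)" for n using fn by (simp add: attain_def)
  have "(\<lambda>n. r (fn n) x - r f x) \<longlonglongrightarrow> 0"
  proof (rule Lim_null_comparison)
    show "\<forall>\<^sub>F n in sequentially. norm (r (fn n) x - r f x) \<le> nrm (\<lambda>m. fn n m - f m) * norm x"
      using r_near[OF i f] by simp
    show "(\<lambda>n. nrm (\<lambda>m. fn n m - f m) * norm x) \<longlonglongrightarrow> 0"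
      using tendsto_mult_left_zero[OF lim] .
  qed
  then have 1: "(\<lambda>n. r (fn n) x) \<longlonglongrightarrow> r f x" by (simp add: LIM_zero_iff)
  have "(\<lambda>n. nrm (fn n) - nrm f) \<longlonglongrightarrow> 0"
  proof (rule Lim_null_comparison[OF _ lim])
    have "\<bar>nrm (fn n) - nrm f\<bar> \<le> nrm (\<lambda>m. fn n m - f m)" for n
    proof -
      have "nrm (fn n) \<le> nrm (\<lambda>m. fn n m - f m) + nrm f"
        using nrm_add_le[of "\<lambda>m. fn n m - f m" f] i[of n] f by simp
      moreover have "nrm f \<le> nrm (\<lambda>m. f m - fn n m) + nrm (fn n)"
        using nrm_add_le[of "\<lambda>m. f m - fn n m" "fn n"] i[of n] f by simp
      ultimately show ?thesis by (simp add: norm_minus_commute)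
    qed
    then show "\<forall>\<^sub>F n in sequentially. norm (nrm (fn n) - nrm f) \<le> nrm (\<lambda>m. fn n m - f m)" by simp
  qed
  then have "(\<lambda>n. nrm (fn n)) \<longlonglongrightarrow> nrm f" by (simp add: LIM_zero_iff)
  then have "(\<lambda>n. nrm (fn n) * norm x) \<longlonglongrightarrow> nrm f * norm x" by (intro tendsto_intros)
  moreover have "(\<lambda>n. r (fn n) x) = (\<lambda>n. nrm (fn n) * norm x)" using fn by (simp add: attain_def)
  ultimately have "r f x = nrm f * norm x" using LIMSEQ_unique[OF 1] by simp
  then show ?thesis using f by (simp add: attain_def)
qed

lemma attain_mult_le_1:
  assumes f: "f \<in> attain x" and w[measurable]: "w \<in> borel_measurable M" and b: "\<And>m. 0 \<le> w m" "\<And>m. w m \<le> 1"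
  shows "(\<lambda>m. w m *\<^sub>R f m) \<in> attain x"
proof -
  have i: "integrable M f" using f by (simp add: attain_def)
  note [measurable] = borel_measurable_integrable[OF i]
  have le: "norm (c *\<^sub>R f m) \<le> norm (f m)" if "0 \<le> c" "c \<le> 1" for c m
    using that mult_left_le_one_le[of "norm (f m)" c] by simp
  have 1: "integrable M (\<lambda>m. w m *\<^sub>R f m)"
    by (rule Bochner_Integration.integrable_bound[OF i]) (use b in \<open>auto intro!: AE_I2 le simp del: norm_scaleR\<close>)
  have 2: "integrable M (\<lambda>m. (1 - w m) *\<^sub>R f m)"
    by (rule Bochner_Integration.integrable_bound[OF i]) (use b in \<open>auto intro!: AE_I2 le simp del: norm_scaleR\<close>)
  have eq: "w m *\<^sub>R f m + (1 - w m) *\<^sub>R f m = f m" for m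
    by (simp add: algebra_simps)
  have "norm (w m *\<^sub>R f m + (1 - w m) *\<^sub>R f m) = norm (w m *\<^sub>R f m) + norm ((1 - w m) *\<^sub>R f m)" for m
    unfolding eq norm_scaleR using b[of m] by (simp add: left_diff_distrib)
  moreover have "(\<lambda>m. w m *\<^sub>R f m + (1 - w m) *\<^sub>R f m) \<in> attain x"
    unfolding eq by (rule f)
  ultimately show ?thesis by (intro attain_summand[OF 1 2])
qed

text \<open>A bounded weight is rescaled into [0, 1] and split off as a summand; the general case
  follows by truncation and closedness of the cone. This permits restriction to a set and
  normalisation to modulus 1.\<close>

lemma attain_mult:
  assumes f: "f \<in> attain x" and w[measurable]: "w \<in> borel_measurable M" and b: "\<And>m. 0 \<le> w m"
    and wf: "integrable M (\<lambda>m. w m *\<^sub>R f m)"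
  shows "(\<lambda>m. w m *\<^sub>R f m) \<in> attain x"
proof (rule attain_lim[where fn="\<lambda>n m. min (w m) (real (Suc n)) *\<^sub>R f m"])
  have i: "integrable M f" using f by (simp add: attain_def)
  note [measurable] = borel_measurable_integrable[OF i]
  show "(\<lambda>m. min (w m) (real (Suc n)) *\<^sub>R f m) \<in> attain x" for n
  proof -
    have "(\<lambda>m. (min (w m) (real (Suc n)) / real (Suc n)) *\<^sub>R f m) \<in> attain x"
      using b by (intro attain_mult_le_1 f) auto
    from attain_scaleR[OF this, of "real (Suc n)"] show ?thesis by simp
  qed
  have "(\<lambda>n. nrm (\<lambda>m. min (w m) (real (Suc n)) *\<^sub>R f m - w m *\<^sub>R f m)) \<longlonglongrightarrow> (\<integral>m. 0 \<partial>M)"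
  proof (rule integral_dominated_convergence[where w="\<lambda>m. norm (w m *\<^sub>R f m)"])
    show "AE m in M. (\<lambda>n. norm (min (w m) (real (Suc n)) *\<^sub>R f m - w m *\<^sub>R f m)) \<longlonglongrightarrow> 0"
    proof (rule AE_I2)
      fix m
      obtain N :: nat where N: "w m \<le> real N" using real_arch_simple by blast
      have "norm (min (w m) (real (Suc n)) *\<^sub>R f m - w m *\<^sub>R f m) = 0" if "n \<ge> N" for n
        using N that by (simp add: min_def)
      then show "(\<lambda>n. norm (min (w m) (real (Suc n)) *\<^sub>R f m - w m *\<^sub>R f m)) \<longlonglongrightarrow> 0"
        by (intro tendsto_eventually eventually_sequentiallyI) auto
    qed
    show "AE m in M. norm (norm (min (w m) (real (Suc n)) *\<^sub>R f m - w m *\<^sub>R f m)) \<le> norm (w m *\<^sub>R f m)" for n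
    proof (rule AE_I2)
      fix m
      have "norm (min (w m) (real (Suc n)) *\<^sub>R f m - w m *\<^sub>R f m) = \<bar>min (w m) (real (Suc n)) - w m\<bar> * norm (f m)"
        by (metis norm_scaleR scaleR_left_diff_distrib)
      also have "\<dots> \<le> \<bar>w m\<bar> * norm (f m)"
        using b[of m] by (intro mult_right_mono) auto
      finally show "norm (norm (min (w m) (real (Suc n)) *\<^sub>R f m - w m *\<^sub>R f m)) \<le> norm (w m *\<^sub>R f m)"
        by simp
    qed
    show "integrable M (\<lambda>m. norm (w m *\<^sub>R f m))" using wf by (rule integrable_norm)
  qed auto
  then show "(\<lambda>n. nrm (\<lambda>m. min (w m) (real (Suc n)) *\<^sub>R f m - w m *\<^sub>R f m)) \<longlonglongrightarrow> 0" by simp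
qed (rule wf)

lemma attain_near:
  assumes g: "linear g" "g x = norm x" "\<And>w. g w \<le> norm w" and x: "x \<noteq> 0"
    and f: "integrable M f" and fg: "\<And>w. r f w - g w \<le> e * norm w" and e: "e \<ge> 0"
  shows "\<exists>h\<in>attain x. nrm h = 1 \<and> nrm (\<lambda>m. f m - h m) \<le> e"
proof -
  obtain h where h: "integrable M h" "r h = g" using r_surj[OF g(1,3)] by blast
  have "nrm h \<le> 1" using h g(3) by (intro r_norming) auto
  moreover have "1 * norm x \<le> nrm h * norm x" using r_bound[OF h(1), of x] h g(2) by simp
  then have "1 \<le> nrm h" using x by simp
  ultimately have "nrm h = 1" by simp
  then have "h \<in> attain x" using h g(2) by (simp add: attain_def)
  moreover have "nrm (\<lambda>m. f m - h m) \<le> e"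
    using h f fg e by (intro r_norming) (auto simp: r_diff)
  ultimately show ?thesis using \<open>nrm h = 1\<close> by blast
qed

lemma SSD_attain:
  assumes "SSD_at x" "norm x = 1" "e > 0"
  shows "\<exists>d>0. \<forall>f. integrable M f \<longrightarrow> nrm f \<le> 1 \<longrightarrow> 1 - d \<le> r f x \<longrightarrow>
    (\<exists>h\<in>attain x. nrm (\<lambda>m. f m - h m) \<le> e)"
proof -
  obtain d where d: "d > 0" "\<And>f. \<lbrakk>linear f; \<And>w. f w \<le> norm w; 1 - d \<le> f x\<rbrakk> \<Longrightarrow>
    \<exists>g. linear g \<and> g x = 1 \<and> (\<forall>w. g w \<le> norm w) \<and> (\<forall>w. f w - g w \<le> e * norm w)"
    using SSD_at_norming_functional_near[OF assms] by blast
  have "\<exists>h\<in>attain x. nrm (\<lambda>m. f m - h m) \<le> e"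
    if f: "integrable M f" "nrm f \<le> 1" "1 - d \<le> r f x" for f
  proof -
    have "r f w \<le> norm w" for w
      using r_bound[OF f(1), of w] mult_right_mono[OF f(2), of "norm w"] by simp
    from d(2)[OF r_linear[OF f(1)] this f(3)] obtain g where
      g: "linear g" "g x = 1" "\<And>w. g w \<le> norm w" "\<And>w. r f w - g w \<le> e * norm w" by blast
    have "g x = norm x" "x \<noteq> 0" using g(2) assms(2) by auto
    with attain_near[OF g(1) _ g(3) _ f(1) g(4)] assms(3) show ?thesis by auto
  qed
  with d(1) show ?thesis by blast
qed

text \<open>The condition \<open>d < l * norm x0\<close> guarantees \<open>x \<noteq> 0\<close>,
  because \<open>x\<close> lies within \<open>d / l\<close> of \<open>x0\<close>.\<close>

lemma bishop_phelps_attain: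
  assumes f: "integrable M f" "nrm f \<le> 1" and x0: "norm x0 - d \<le> r f x0" and l: "l > 0"
    and nz: "d < l * norm x0"
  shows "\<exists>x. \<exists>h\<in>attain x. x \<noteq> 0 \<and> nrm (\<lambda>m. f m - h m) \<le> l \<and> l * norm (x - x0) \<le> d"
proof -
  have "r f w \<le> norm w" for w
    using r_bound[OF f(1), of w] mult_right_mono[OF f(2), of "norm w"] by simp
  from bishop_phelps_bollobas[OF r_linear[OF f(1)] this x0 l] obtain x g where
    g: "linear g" "g x = norm x" "\<And>w. g w \<le> norm w" "\<And>w. r f w - g w \<le> l * norm w"
      "l * norm (x - x0) \<le> d" by blast
  have "x \<noteq> 0" using g(5) nz by auto
  with attain_near[OF g(1-3) _ f(1) g(4)] l g(5) show ?thesis by auto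
qed

end

section \<open>Diffuse sets contradict strong subdifferentiability\<close>

locale diffuse_L1_pairing = L1_pairing M r
  for M :: "'m measure" and r :: "('m \<Rightarrow> 'k::euclidean_space) \<Rightarrow> 'a::banach \<Rightarrow> real" +
  fixes A :: "'m set"
  assumes A_sets[measurable]: "A \<in> sets M"
    and A_finite: "emeasure M A < \<infinity>"
    and A_pos: "0 < measure M A"
    and diffuse: "\<And>B. \<lbrakk>B \<in> sets M; B \<subseteq> A; 0 < measure M B\<rbrakk> \<Longrightarrow>
      \<exists>C\<in>sets M. C \<subseteq> B \<and> 0 < measure M C \<and> measure M C < measure M B"
    and ssd: "\<And>x :: 'a. norm x = 1 \<Longrightarrow> SSD_at x"
begin

lemma integrable_on_A:
  fixes f :: "'m \<Rightarrow> 'k"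
  assumes "f \<in> borel_measurable M" "\<And>m. norm (f m) \<le> K" "\<And>m. m \<notin> A \<Longrightarrow> f m = 0"
  shows "integrable M f"
  by (rule integrableI_bounded_set[where A=A and B=K]) (use assms A_finite in auto)

lemma measure_mono_A: "\<lbrakk>B \<in> sets M; C \<in> sets M; B \<subseteq> C; C \<subseteq> A\<rbrakk> \<Longrightarrow> measure M B \<le> measure M C"
  using A_finite emeasure_mono[of C A M] by (intro measure_mono_fmeasurable) (auto simp: fmeasurable_def)

lemma emeasure_A_finite: "B \<in> sets M \<Longrightarrow> B \<subseteq> A \<Longrightarrow> emeasure M B < \<infinity>"
  using A_finite emeasure_mono[of B A M] by auto

definition attain_A :: "'a \<Rightarrow> ('m \<Rightarrow> 'k) set" where
  "attain_A x = {f \<in> attain x. \<forall>m. m \<notin> A \<longrightarrow> f m = 0}"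

definition unimodular :: "('m \<Rightarrow> 'k) \<Rightarrow> bool" where
  "unimodular u \<longleftrightarrow> (\<forall>m. norm (u m) = 0 \<or> norm (u m) = 1)"

text \<open>Such a \<open>u\<close> is determined up to null sets, and its support contains that of
  every member of the cone. With \<open>attain_mult\<close> the cone consists, up to null sets, of
  the integrable nonnegative multiples of \<open>u\<close>.\<close>

definition maximal_phase :: "'a \<Rightarrow> ('m \<Rightarrow> 'k) \<Rightarrow> bool" where
  "maximal_phase x u \<longleftrightarrow> u \<in> attain_A x \<and> unimodular u \<and>
    (\<forall>f\<in>attain_A x. AE m in M. f m = norm (f m) *\<^sub>R u m)"

lemma attain_A_scale_point: "c > 0 \<Longrightarrow> attain_A (c *\<^sub>R x) = attain_A x"
  by (simp add: attain_A_def attain_scale_point)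

lemma maximal_phase_scale_point: "c > 0 \<Longrightarrow> maximal_phase (c *\<^sub>R x) = maximal_phase x"
  by (simp add: maximal_phase_def attain_A_scale_point fun_eq_iff)

text \<open>Here \<open>attain_mult\<close> is used with the weight
  \<open>inverse (norm (f m))\<close>, which is 0 where \<open>f\<close> vanishes; finiteness of the
  measure of \<open>A\<close> makes the product integrable.\<close>

lemma sgn_attain_A:
  assumes f: "f \<in> attain_A x"
  shows "(\<lambda>m. sgn (f m)) \<in> attain_A x" "unimodular (\<lambda>m. sgn (f m))"
proof -
  have i: "integrable M f" using f by (simp add: attain_A_def attain_def)
  note [measurable] = borel_measurable_integrable[OF i]
  have "integrable M (\<lambda>m. sgn (f m))"
    by (rule integrable_on_A[where K=1]) (use f in \<open>auto simp: attain_A_def norm_sgn\<close>)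
  then have "(\<lambda>m. inverse (norm (f m)) *\<^sub>R f m) \<in> attain x"
    using f by (intro attain_mult) (auto simp: attain_A_def sgn_div_norm)
  then show "(\<lambda>m. sgn (f m)) \<in> attain_A x"
    using f by (auto simp: attain_A_def sgn_div_norm)
qed (auto simp: unimodular_def norm_sgn)

lemma unimodular_nrm:
  assumes u: "u \<in> borel_measurable M" "unimodular u" "\<And>m. m \<notin> A \<Longrightarrow> u m = 0"
  shows "nrm u = measure M {m\<in>A. u m \<noteq> 0}"
proof -
  note [measurable] = u(1)
  have "norm (u m) = indicator {m\<in>A. u m \<noteq> 0} m" for m
    using u(2,3) by (auto simp: unimodular_def split: split_indicator)
  moreover have "{m\<in>A. u m \<noteq> 0} \<in> sets M" by measurable
  ultimately show ?thesis using sets.sets_into_space[of "{m\<in>A. u m \<noteq> 0}" M]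
    by (simp add: Int_absorb2)
qed

text \<open>Exhaustion: for unimodular functions \<open>nrm\<close> measures the support. A weighted
  sum of a maximising sequence lies in the cone and, for want of cancellation, its support contains
  all of theirs; its sign function is the phase.\<close>

lemma ex_maximal_phase:
  assumes x: "x \<noteq> 0"
  shows "\<exists>u. maximal_phase x u"
proof -
  define U where "U = {u \<in> attain_A x. unimodular u}"
  have U_int: "integrable M u" if "u \<in> U" for u
    using that by (auto simp: U_def attain_A_def attain_def)
  have U_le: "norm (u m) \<le> indicator A m" if "u \<in> U" for u m
  proof -
    have "norm (u m) = 0 \<or> norm (u m) = 1" "m \<notin> A \<longrightarrow> u m = 0"
      using that by (auto simp: U_def attain_A_def unimodular_def)
    then show ?thesis by (auto split: split_indicator)
  qed
  have U_bdd: "nrm u \<le> measure M A" if "u \<in> U" for u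
  proof -
    have "nrm u \<le> (\<integral>m. indicator A m \<partial>M)"
      using that A_finite by (intro integral_mono integrable_norm U_int U_le) auto
    then show ?thesis using sets.sets_into_space[OF A_sets] by (simp add: Int_absorb2)
  qed
  have bdd: "bdd_above (nrm ` U)" using U_bdd by (intro bdd_aboveI2) auto
  have "(\<lambda>m. 0) \<in> U"
    using linear_0 r_scaleR[of "\<lambda>m. 0" 0 x] by (auto simp: U_def attain_A_def attain_def unimodular_def)
  then have ne: "nrm ` U \<noteq> {}" by blast
  define s where "s = Sup (nrm ` U)"
  have "\<exists>u\<in>U. s - 1 / real (Suc n) < nrm u" for n
  proof -
    have "s - 1 / real (Suc n) < Sup (nrm ` U)" by (simp add: s_def)
    then show ?thesis using less_cSup_iff[OF ne bdd] by auto
  qed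
  then obtain u where u: "\<And>n. u n \<in> U" "\<And>n. s - 1 / real (Suc n) < nrm (u n)" by metis
  note [measurable] = borel_measurable_integrable[OF U_int[OF u(1)]]
  have uN: "u n \<in> attain_A x" for n using u(1) by (simp add: U_def)
  define p where "p N m = (\<Sum>n<N. (1/2) ^ n *\<^sub>R u n m)" for N m
  define f where "f m = (\<Sum>n. (1/2) ^ n *\<^sub>R u n m)" for m
  have p_attain: "p N \<in> attain x" for N
  proof (induction N)
    case 0
    then show ?case using r_scaleR[of "\<lambda>m. 0" 0 x] by (simp add: p_def[abs_def] attain_def)
  next
    case (Suc N)
    have "(\<lambda>m. p N m + (1/2) ^ N *\<^sub>R u N m) \<in> attain x"
      using uN by (intro attain_add Suc attain_scaleR) (auto simp: attain_A_def)
    then show ?case by (simp add: p_def[abs_def])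
  qed
  have term_le: "norm ((1/2) ^ n *\<^sub>R u n m) \<le> (1/2) ^ n" for n m
    using U_le[OF u(1), of n m] by (auto split: split_indicator_asm)
  have summ: "summable (\<lambda>n. norm ((1/2) ^ n *\<^sub>R u n m))" for m
    by (rule summable_comparison_test'[OF summable_geometric[of "1/2::real"]]) (use term_le in auto)
  have f_le: "norm (f m) \<le> 2" for m
  proof -
    have "norm (f m) \<le> (\<Sum>n. norm ((1/2) ^ n *\<^sub>R u n m))"
      unfolding f_def by (rule summable_norm[OF summ])
    also have "\<dots> \<le> (\<Sum>n. (1/2) ^ n)"
      by (intro suminf_le term_le summ summable_geometric) auto
    finally show ?thesis by (simp add: suminf_geometric)
  qed
  have p_le: "norm (p N m) \<le> 2" for N m
  proof -
    have "norm (p N m) \<le> (\<Sum>n<N. (1/2) ^ n)"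
      unfolding p_def by (intro sum_norm_le term_le)
    also have "\<dots> \<le> (\<Sum>n. (1/2::real) ^ n)" by (intro sum_le_suminf summable_geometric) auto
    finally show ?thesis by (simp add: suminf_geometric)
  qed
  have p_lim: "(\<lambda>N. p N m) \<longlonglongrightarrow> f m" for m
    unfolding p_def f_def by (rule summable_LIMSEQ[OF summable_norm_cancel[OF summ]])
  have f_meas[measurable]: "f \<in> borel_measurable M" unfolding f_def[abs_def] by measurable
  have p_meas[measurable]: "p N \<in> borel_measurable M" for N unfolding p_def[abs_def] by measurable
  have off: "m \<notin> A \<Longrightarrow> u n m = 0" for m n using uN by (auto simp: attain_A_def)
  have f_off: "m \<notin> A \<Longrightarrow> f m = 0" and p_off: "m \<notin> A \<Longrightarrow> p N m = 0" for m N
    using off by (simp_all add: f_def p_def)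
  have f_int: "integrable M f" by (rule integrable_on_A[OF f_meas f_le f_off])
  have "f \<in> attain x"
  proof (rule attain_lim[OF p_attain f_int])
    have "(\<lambda>N. nrm (\<lambda>m. p N m - f m)) \<longlonglongrightarrow> (\<integral>m. 0 \<partial>M)"
    proof (rule integral_dominated_convergence[where w="\<lambda>m. 4 * indicator A m"])
      show "integrable M (\<lambda>m. 4 * indicator A m :: real)" using A_finite by simp
      show "AE m in M. (\<lambda>N. norm (p N m - f m)) \<longlonglongrightarrow> 0"
        using p_lim by (simp add: tendsto_norm_zero LIM_zero)
      show "AE m in M. norm (norm (p N m - f m)) \<le> 4 * indicator A m" for N
      proof (rule AE_I2)
        fix m
        have "norm (p N m - f m) \<le> 4"
          using norm_triangle_ineq4[of "p N m" "f m"] p_le[of N m] f_le[of m] by simp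
        then show "norm (norm (p N m - f m)) \<le> 4 * indicator A m"
          using f_off p_off by (auto split: split_indicator)
      qed
    qed auto
    then show "(\<lambda>N. nrm (\<lambda>m. p N m - f m)) \<longlonglongrightarrow> 0" by simp
  qed
  then have fN: "f \<in> attain_A x" using f_off by (simp add: attain_A_def)
  \<comment> \<open>Equality in every triangle inequality makes the norms of the partial sums
    increase, so \<open>f\<close> cannot vanish where some \<open>u n\<close> does not.\<close>
  have "AE m in M. \<forall>N. norm (p (Suc N) m) = norm (p N m) + norm ((1/2) ^ N *\<^sub>R u N m)"
    unfolding AE_all_countable
  proof
    fix N
    have "AE m in M. norm (p N m + (1/2) ^ N *\<^sub>R u N m) = norm (p N m) + norm ((1/2) ^ N *\<^sub>R u N m)"
      using uN x by (intro attain_add_norm[OF p_attain attain_scaleR]) (auto simp: attain_A_def)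
    then show "AE m in M. norm (p (Suc N) m) = norm (p N m) + norm ((1/2) ^ N *\<^sub>R u N m)"
      by (simp add: p_def)
  qed
  then have supp: "AE m in M. \<forall>n. f m = 0 \<longrightarrow> u n m = 0"
  proof eventually_elim
    case (elim m)
    have "norm ((1/2) ^ n *\<^sub>R u n m) \<le> norm (p N m)" if "Suc n \<le> N" for n N
      using that
    proof (induction N rule: dec_induct)
      case base then show ?case using elim[rule_format, of n] by simp
    next
      case (step N) then show ?case using elim[rule_format, of N] by (smt (verit) norm_ge_zero)
    qed
    then have "norm ((1/2) ^ n *\<^sub>R u n m) \<le> norm (f m)" for n
      by (intro LIMSEQ_le_const[OF tendsto_norm[OF p_lim]]) blast
    then have "f m = 0 \<Longrightarrow> (1/2) ^ n * norm (u n m) \<le> 0" for n by fastforce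
    moreover have "\<not> (1/2::real) ^ n \<le> 0" for n by (simp add: not_le)
    ultimately show ?case by (auto simp: mult_le_0_iff)
  qed
  define v where "v m = sgn (f m)" for m
  have vU: "v \<in> U" unfolding U_def v_def[abs_def] using sgn_attain_A[OF fN] by simp
  have v_ge: "s \<le> nrm v"
  proof (rule field_le_epsilon)
    fix e :: real assume "e > 0"
    then obtain n where n: "1 / real (Suc n) < e" using nat_approx_posE by blast
    have "AE m in M. norm (u n m) \<le> norm (v m)"
      using supp
    proof eventually_elim
      case (elim m)
      have "norm (u n m) = 0 \<or> norm (u n m) = 1" using u(1)[of n] by (simp add: U_def unimodular_def)
      with elim show ?case by (cases "f m = 0") (auto simp: v_def norm_sgn)
    qed
    then have "nrm (u n) \<le> nrm v" by (intro integral_mono_AE integrable_norm U_int u(1) vU)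
    with u(2)[of n] n show "s \<le> nrm v + e" by simp
  qed
  have "AE m in M. g m = norm (g m) *\<^sub>R v m" if g: "g \<in> attain_A x" for g
  proof -
    have "(\<lambda>m. f m + g m) \<in> attain_A x"
      using fN g by (auto simp: attain_A_def attain_add)
    from sgn_attain_A[OF this] have wU: "(\<lambda>m. sgn (f m + g m)) \<in> U" by (simp add: U_def)
    have eq: "AE m in M. norm (f m + g m) = norm (f m) + norm (g m)"
      using fN g x by (intro attain_add_norm) (auto simp: attain_A_def)
    \<comment> \<open>As \<open>s\<close> is the supremum, adding \<open>g\<close> cannot enlarge
      the support of \<open>f\<close>; hence \<open>g\<close> vanishes almost everywhere that
      \<open>f\<close> does.\<close>
    have "AE m in M. norm (v m) = norm (sgn (f m + g m))"
    proof (rule AE_eq_of_integral_le)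
      show "AE m in M. norm (v m) \<le> norm (sgn (f m + g m))"
        using eq by eventually_elim (auto simp: v_def norm_sgn add_nonneg_eq_0_iff)
      have "nrm (\<lambda>m. sgn (f m + g m)) \<le> s" unfolding s_def using wU bdd by (intro cSup_upper) auto
      with v_ge show "nrm (\<lambda>m. sgn (f m + g m)) \<le> nrm v" by simp
    qed (intro integrable_norm U_int vU wU)+
    with eq show ?thesis
    proof eventually_elim
      case (elim m)
      show ?case
      proof (cases "f m = 0")
        case True
        with elim(2) show ?thesis by (auto simp: v_def norm_sgn split: if_splits)
      next
        case False
        have "norm (f m) *\<^sub>R g m = norm (g m) *\<^sub>R f m" using elim(1) norm_triangle_eq by blast
        then have "inverse (norm (f m)) *\<^sub>R (norm (f m) *\<^sub>R g m) = inverse (norm (f m)) *\<^sub>R (norm (g m) *\<^sub>R f m)"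
          by simp
        with False show ?thesis by (simp add: v_def sgn_div_norm mult.commute)
      qed
    qed
  qed
  then have "maximal_phase x v" using vU by (simp add: maximal_phase_def U_def)
  then show ?thesis by blast
qed

text \<open>Restricting \<open>h\<close> to \<open>A\<close> keeps it in the cone and cannot
  increase its distance to a function that vanishes off \<open>A\<close>.\<close>

lemma attain_A_near:
  assumes f: "integrable M f" "\<And>m. m \<notin> A \<Longrightarrow> f m = 0"
    and h: "h \<in> attain x" "nrm (\<lambda>m. f m - h m) \<le> e"
  shows "\<exists>h\<in>attain_A x. nrm (\<lambda>m. f m - h m) \<le> e"
proof
  have hi: "integrable M h" using h(1) by (rule attain_integrable)
  let ?h = "\<lambda>m. indicator A m *\<^sub>R h m"
  have hi': "integrable M ?h" using hi by (intro integrable_mult_indicator) auto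
  have "?h \<in> attain x" using h(1) by (intro attain_mult hi') auto
  then show "?h \<in> attain_A x" by (simp add: attain_A_def)
  have "nrm (\<lambda>m. f m - ?h m) \<le> nrm (\<lambda>m. f m - h m)"
  proof (rule integral_mono)
    show "norm (f m - ?h m) \<le> norm (f m - h m)" for m
      using f(2) by (auto split: split_indicator)
    show "integrable M (\<lambda>m. norm (f m - ?h m))" "integrable M (\<lambda>m. norm (f m - h m))"
      using f(1) hi hi' by auto
  qed
  with h(2) show "nrm (\<lambda>m. f m - ?h m) \<le> e" by simp
qed

lemma SSD_attain_A:
  assumes "norm x = 1" "e > 0"
  shows "\<exists>d>0. \<forall>f. integrable M f \<longrightarrow> (\<forall>m. m \<notin> A \<longrightarrow> f m = 0) \<longrightarrow> nrm f \<le> 1 \<longrightarrow> 1 - d \<le> r f x \<longrightarrow>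
    (\<exists>h\<in>attain_A x. nrm (\<lambda>m. f m - h m) \<le> e)"
proof -
  obtain d where "d > 0"
    and d: "\<And>f. \<lbrakk>integrable M f; nrm f \<le> 1; 1 - d \<le> r f x\<rbrakk> \<Longrightarrow> \<exists>h\<in>attain x. nrm (\<lambda>m. f m - h m) \<le> e"
    using SSD_attain[OF ssd[OF assms(1)] assms] by blast
  have "\<exists>h\<in>attain_A x. nrm (\<lambda>m. f m - h m) \<le> e"
    if "integrable M f" "\<forall>m. m \<notin> A \<longrightarrow> f m = 0" "nrm f \<le> 1" "1 - d \<le> r f x" for f
    using d[OF that(1,3,4)] attain_A_near[of f _ x e] that(1,2) by blast
  with \<open>d > 0\<close> show ?thesis by blast
qed

lemma bishop_phelps_attain_A:
  assumes f: "integrable M f" "\<And>m. m \<notin> A \<Longrightarrow> f m = 0" "nrm f \<le> 1"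
    and "norm x0 - d \<le> r f x0" "l > 0" "d < l * norm x0"
  shows "\<exists>x. \<exists>h\<in>attain_A x. x \<noteq> 0 \<and> nrm (\<lambda>m. f m - h m) \<le> l \<and> l * norm (x - x0) \<le> d"
proof -
  obtain x h where "h \<in> attain x" "x \<noteq> 0" "nrm (\<lambda>m. f m - h m) \<le> l" "l * norm (x - x0) \<le> d"
    using bishop_phelps_attain[OF f(1,3) assms(4-6)] by blast
  then show ?thesis using attain_A_near[OF f(1,2), of h x l] by blast
qed

lemma nrm_pos_of_near:
  assumes "integrable M f" "integrable M h" "nrm (\<lambda>m. f m - h m) < nrm f"
  shows "nrm h > 0"
  using nrm_add_le[of "\<lambda>m. f m - h m" h] assms by simp

lemma maximal_phase_nrm_pos:
  assumes u: "maximal_phase x u" and h: "h \<in> attain_A x" "nrm h > 0"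
  shows "nrm u > 0"
proof (rule ccontr)
  assume "\<not> nrm u > 0"
  moreover have "0 \<le> nrm u" by simp
  ultimately have "nrm u = 0" by linarith
  moreover have "integrable M u" using u by (simp add: maximal_phase_def attain_A_def attain_def)
  ultimately have "AE m in M. norm (u m) = 0"
    using integral_nonneg_eq_0_iff_AE[of M "\<lambda>m. norm (u m)"] by simp
  moreover have "AE m in M. h m = norm (h m) *\<^sub>R u m" using u h by (simp add: maximal_phase_def)
  ultimately have "AE m in M. norm (h m) = 0" by eventually_elim auto
  then have "nrm h = 0" by (rule integral_eq_zero_AE)
  with h(2) show False by simp
qed

text \<open>The normalised phase at the new point has constant modulus \<open>1/t\<close> on its
  support of measure \<open>t\<close>. By SSD at \<open>x\<close> it is near \<open>1/t\<close>
  times a restriction of \<open>u\<close>, and on every such restriction \<open>y0\<close> is at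
  most about \<open>b1 \<le> s / 2\<close>. Since its value at \<open>y0\<close> is close to 1,
  \<open>t\<close> is well below \<open>s\<close>.\<close>

lemma shrink_maximal_phase:
  assumes x: "norm x = 1" and u: "maximal_phase x u" "nrm u > 0" and e0: "e0 > 0"
  shows "\<exists>x' u'. norm x' = 1 \<and> norm (x' - x) < e0 \<and> maximal_phase x' u' \<and> 0 < nrm u' \<and> nrm u' \<le> 7/10 * nrm u"
proof -
  have uN: "u \<in> attain_A x" and uU: "unimodular u" using u(1) by (auto simp: maximal_phase_def)
  have u_int: "integrable M u" using uN by (simp add: attain_A_def attain_def)
  note [measurable] = borel_measurable_integrable[OF u_int]
  have u_off: "u m = 0" if "m \<notin> A" for m using uN that by (simp add: attain_A_def)
  have u_norm: "norm (u m) = 1" if "u m \<noteq> 0" for m using uU that by (force simp: unimodular_def)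
  define B where "B = {m\<in>A. u m \<noteq> 0}"
  have B[measurable]: "B \<in> sets M" and BA: "B \<subseteq> A" by (auto simp: B_def)
  define s where "s = nrm u"
  have s: "s = measure M B" "s > 0" using unimodular_nrm[of u] uU u_off u(2) by (auto simp: s_def B_def)
  \<comment> \<open>\<open>diffuse\<close> cuts \<open>B\<close> into two parts of positive measure,
    and one of them has at most half the measure.\<close>
  obtain B1 where B1[measurable]: "B1 \<in> sets M" and B1B: "B1 \<subseteq> B" and B1_pos: "0 < measure M B1"
    and B1_le: "measure M B1 \<le> s / 2"
  proof -
    obtain C where C: "C \<in> sets M" "C \<subseteq> B" "0 < measure M C" "measure M C < measure M B"
      using diffuse[OF B BA] s by auto
    have "measure M (B - C) = measure M B - measure M C"
      using C emeasure_A_finite[OF B BA] by (intro measure_Diff) auto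
    with C s that[of C] that[of "B - C"] show ?thesis
      by (cases "measure M C \<le> s / 2") auto
  qed
  define b1 where "b1 = measure M B1"
  have b1: "0 < b1" "b1 \<le> s / 2" using B1_pos B1_le by (auto simp: b1_def)
  have meas_split: "measure M E = measure M (E \<inter> F) + measure M (E - F)"
    if [measurable]: "E \<in> sets M" "F \<in> sets M" and "E \<subseteq> A" for E F
  proof -
    have "emeasure M (E \<inter> F) \<noteq> \<infinity>" "emeasure M (E - F) \<noteq> \<infinity>"
      using emeasure_A_finite[of "E \<inter> F"] emeasure_A_finite[of "E - F"] that
        subset_trans[OF Int_lower1 that(3)] subset_trans[OF Diff_subset that(3)] by auto
    from measure_Union[OF this] that show ?thesis by (simp add: Int_Diff_Un Int_Diff_disjoint)
  qed
  define U where "U E m = indicator E m *\<^sub>R u m" for E m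
  have U_int: "integrable M (U E)" if "E \<in> sets M" for E
    unfolding U_def[abs_def] using that u_int by (rule integrable_mult_indicator)
  have U_attain: "U E \<in> attain x" if [measurable]: "E \<in> sets M" for E
    unfolding U_def[abs_def]
    using uN integrable_mult_indicator[OF that u_int] by (intro attain_mult) (auto simp: attain_A_def)
  have U_nrm: "nrm (U E) = measure M E" if [measurable]: "E \<in> sets M" and "E \<subseteq> B" for E
  proof -
    have "norm (U E m) = indicator E m" for m
      using that u_norm[of m] by (auto simp: U_def B_def split: split_indicator)
    then show ?thesis using sets.sets_into_space[OF that(1)] by (simp add: Int_absorb2)
  qed
  have U_split: "r (U E) y = r (U (E \<inter> F)) y + r (U (E - F)) y"
    if [measurable]: "E \<in> sets M" "F \<in> sets M" for E F y
  proof -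
    have "r (\<lambda>m. U (E \<inter> F) m + U (E - F) m) y = r (U (E \<inter> F)) y + r (U (E - F)) y"
      by (intro r_add U_int) auto
    moreover have "(\<lambda>m. U (E \<inter> F) m + U (E - F) m) = U E"
      by (auto simp: U_def fun_eq_iff split: split_indicator)
    ultimately show ?thesis by simp
  qed
  have U_abs: "\<bar>r (U E) y\<bar> \<le> measure M E" if E[measurable]: "E \<in> sets M" "E \<subseteq> B" and y: "norm y \<le> 1" for E y
  proof -
    have "\<bar>r (U E) y\<bar> \<le> measure M E * norm y"
      using r_abs_bound[OF U_int[OF E(1)], of y] U_nrm[OF E] by simp
    also have "\<dots> \<le> measure M E" using y by (intro mult_right_le_one_le) auto
    finally show ?thesis .
  qed
  have b2: "measure M (B - B1) = s - b1"
    using meas_split[OF B B1 BA] B1B s by (simp add: b1_def Int_absorb1)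
  \<comment> \<open>The defect is a fraction of \<open>b1\<close>, not of \<open>s\<close>, because
    \<open>g1\<close> below is normalised by \<open>b1\<close>.\<close>
  obtain y0 where y0: "norm y0 \<le> 1" and y0_ge: "s - b1/200 \<le> r (U B1) y0 - r (U (B - B1)) y0"
  proof -
    let ?G = "\<lambda>m. U B1 m - U (B - B1) m"
    have Gi: "integrable M ?G" by (intro Bochner_Integration.integrable_diff U_int) auto
    have "norm (?G m) = norm (u m)" for m
      using B1B u_off by (auto simp: U_def B_def split: split_indicator)
    then have "nrm ?G = s" by (simp add: s_def)
    with r_almost_norming[OF Gi, of "b1/200"] b1 obtain y where "norm y \<le> 1" "s - b1/200 \<le> r ?G y"
      by auto
    moreover have "r ?G y = r (U B1) y - r (U (B - B1)) y" by (intro r_diff U_int) auto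
    ultimately show ?thesis using that by simp
  qed
  \<comment> \<open>The part of \<open>E\<close> in \<open>B1\<close> contributes at most
    \<open>b1\<close>. On \<open>B - B1\<close> the value at \<open>y0\<close> is within
    \<open>b1/200\<close> of the least possible one, so no part of it contributes more than
    \<open>b1/200\<close>.\<close>
  have UE_le: "r (U E) y0 \<le> b1 + b1/200" if E[measurable]: "E \<in> sets M" and EB: "E \<subseteq> B" for E
  proof -
    have 1: "r (U E) y0 = r (U (E \<inter> B1)) y0 + r (U (E - B1)) y0" by (intro U_split) auto
    have "measure M (E \<inter> B1) \<le> b1" unfolding b1_def
      using B1B BA by (intro measure_mono_A) auto
    moreover have "\<bar>r (U (E \<inter> B1)) y0\<bar> \<le> measure M (E \<inter> B1)" using EB y0 by (intro U_abs) auto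
    ultimately have 2: "r (U (E \<inter> B1)) y0 \<le> b1" by simp
    have "r (U (B - B1)) y0 = r (U ((B - B1) \<inter> E)) y0 + r (U (B - B1 - E)) y0" by (intro U_split) auto
    moreover have "(B - B1) \<inter> E = E - B1" using EB by blast
    moreover have "\<bar>r (U (B - B1 - E)) y0\<bar> \<le> measure M (B - B1 - E)" using y0 by (intro U_abs) auto
    moreover have "measure M (B - B1 - E) \<le> s - b1"
      unfolding b2[symmetric] using BA by (intro measure_mono_A) auto
    moreover have "\<bar>r (U B1) y0\<bar> \<le> b1" unfolding b1_def using B1B y0 by (intro U_abs) auto
    ultimately have "r (U (E - B1)) y0 \<le> b1/200" using y0_ge by simp
    with 1 2 show ?thesis by simp
  qed
  define g1 where "g1 m = (1/b1) *\<^sub>R U B1 m" for m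
  have g1_int: "integrable M g1" unfolding g1_def[abs_def] using U_int[OF B1] by simp
  have g1_nrm: "nrm g1 = 1" using U_nrm[OF B1 B1B] b1 by (simp add: g1_def b1_def)
  have g1_r: "r g1 y = r (U B1) y / b1" for y
    using r_scaleR[OF U_int[OF B1], of "1/b1" y] by (simp add: g1_def[abs_def])
  have g1_off: "g1 m = 0" if "m \<notin> A" for m using that u_off by (simp add: g1_def U_def)
  have g1_x: "r g1 x = 1"
    using U_attain[OF B1] U_nrm[OF B1 B1B] x b1 by (simp add: g1_r attain_def b1_def)
  have g1_y0: "1 - 1/200 \<le> r g1 y0"
  proof -
    have "\<bar>r (U (B - B1)) y0\<bar> \<le> s - b1" unfolding b2[symmetric] using y0 by (intro U_abs) auto
    then have "b1 * (1 - 1/200) \<le> r (U B1) y0" using y0_ge by simp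
    then show ?thesis using b1 by (simp add: g1_r field_simps)
  qed
  obtain d where d: "d > 0" and d_near: "\<And>f. \<lbrakk>integrable M f; \<forall>m. m \<notin> A \<longrightarrow> f m = 0; nrm f \<le> 1; 1 - d \<le> r f x\<rbrakk>
    \<Longrightarrow> \<exists>h\<in>attain_A x. nrm (\<lambda>m. f m - h m) \<le> 1/20"
    using SSD_attain_A[OF x, of "1/20"] by auto
  \<comment> \<open>Passing from \<open>x'\<close> back to \<open>x\<close> costs at most
    \<open>2 * e\<close>, which \<open>e \<le> d/4\<close> keeps within the SSD modulus
    \<open>d\<close>. The bound \<open>e0/8\<close> absorbs the total move of at most
    \<open>4 * e\<close> after normalisation.\<close>
  define e where "e = min (1/4) (min (e0/8) (d/4))"
  have e: "0 < e" "e \<le> 1/4" "e \<le> e0/8" "e \<le> d/4" using e0 d by (auto simp: e_def)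
  define x0 where "x0 = x + e *\<^sub>R y0"
  have ey0: "norm (e *\<^sub>R y0) \<le> e" using e y0 by (simp add: mult_left_le)
  have x0_norm: "norm x0 \<le> 1 + e" "norm x0 \<ge> 3/4"
  proof -
    have "norm x0 \<le> norm x + norm (e *\<^sub>R y0)" unfolding x0_def by (rule norm_triangle_ineq)
    moreover have "norm x \<le> norm x0 + norm (e *\<^sub>R y0)"
      using norm_triangle_ineq4[of x0 "e *\<^sub>R y0"] by (simp add: x0_def)
    ultimately show "norm x0 \<le> 1 + e" "norm x0 \<ge> 3/4" using x ey0 e by linarith+
  qed
  have g1_x0: "1 + e * (1 - 1/200) \<le> r g1 x0"
    using g1_y0 e by (simp add: x0_def r_add_point r_scale_point g1_int g1_x)
  \<comment> \<open>The defect of \<open>g1\<close> at \<open>x0\<close> is at most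
    \<open>e/200\<close>. With slope \<open>1/10\<close> the point moves by at most
    \<open>e/20\<close>, little against \<open>e\<close>, and the functional by at most
    \<open>1/10\<close>, so that it stays nonzero.\<close>
  obtain x' h where x'0: "x' \<noteq> 0" and h: "h \<in> attain_A x'" "nrm (\<lambda>m. g1 m - h m) \<le> 1/10"
    and x'x0: "1/10 * norm (x' - x0) \<le> e/200"
  proof -
    have "norm x0 - e/200 \<le> r g1 x0" using g1_x0 x0_norm by (simp add: algebra_simps)
    moreover have "e/200 < 1/10 * norm x0" using e x0_norm by simp
    ultimately show ?thesis
      using bishop_phelps_attain_A[OF g1_int g1_off, of x0 "e/200" "1/10"] g1_nrm that by auto
  qed
  have h_int: "integrable M h" using h by (simp add: attain_A_def attain_def)
  have h_pos: "nrm h > 0" using nrm_pos_of_near[OF g1_int h_int] h(2) g1_nrm by simp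
  have dx0: "norm (x' - x0) \<le> e/20" using x'x0 by simp
  have dx: "norm (x' - x) \<le> 2 * e"
  proof -
    have "norm (x' - x) = norm ((x' - x0) + e *\<^sub>R y0)" by (simp add: x0_def)
    also have "\<dots> \<le> norm (x' - x0) + norm (e *\<^sub>R y0)" by (rule norm_triangle_ineq)
    finally show ?thesis using dx0 ey0 e by linarith
  qed
  have near_le: "\<bar>r f x' - r f x0\<bar> \<le> e/20" "\<bar>r f x' - r f x\<bar> \<le> 2 * e"
    if "integrable M f" "nrm f = 1" for f
    using r_abs_bound[of f "x' - x0"] r_abs_bound[of f "x' - x"] that dx0 dx by (auto simp: r_diff_point)
  have x'_norm: "1 + 9/10 * e \<le> norm x'"
  proof -
    have "r g1 x' \<le> norm x'" using r_bound[OF g1_int, of x'] g1_nrm by simp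
    moreover have "r g1 x0 \<le> r g1 x' + e/20" using near_le(1)[OF g1_int g1_nrm] by linarith
    moreover have "e * (1 - 1/200) = e - e/200" by (simp add: algebra_simps)
    ultimately show ?thesis using g1_x0 e by linarith
  qed
  obtain v where v: "maximal_phase x' v" using ex_maximal_phase[OF x'0] by blast
  have v_pos: "nrm v > 0" using maximal_phase_nrm_pos[OF v h(1) h_pos] .
  have vN: "v \<in> attain_A x'" and vU: "unimodular v" using v by (auto simp: maximal_phase_def)
  have v_int: "integrable M v" using vN by (simp add: attain_A_def attain_def)
  note [measurable] = borel_measurable_integrable[OF v_int]
  define t where "t = nrm v"
  have t: "t > 0" using v_pos by (simp add: t_def)
  define f where "f m = (1/t) *\<^sub>R v m" for m
  have f_int: "integrable M f" unfolding f_def[abs_def] using v_int by simp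
  have f_nrm: "nrm f = 1" using t by (simp add: f_def t_def)
  have f_x': "r f x' = norm x'"
    using r_scaleR[OF v_int, of "1/t" x'] vN t by (simp add: f_def[abs_def] attain_A_def attain_def t_def)
  have f_off: "\<forall>m. m \<notin> A \<longrightarrow> f m = 0" using vN by (simp add: f_def attain_A_def)
  have "1 - d \<le> r f x" using near_le(2)[OF f_int f_nrm] f_x' x'_norm e by simp
  with d_near[OF f_int f_off] f_nrm obtain g where g: "g \<in> attain_A x" "nrm (\<lambda>m. f m - g m) \<le> 1/20" by auto
  have g_int: "integrable M g" using g by (simp add: attain_A_def attain_def)
  \<comment> \<open>\<open>f\<close> is at least \<open>1 + 17/20 * e\<close> at \<open>x0\<close>
    and at most 1 at \<open>x\<close>. The points differ by \<open>e *\<^sub>R y0\<close>, so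
    dividing by \<open>e\<close> gives a bound that does not depend on the step.\<close>
  have f_y0: "17/20 \<le> r f y0"
  proof -
    have "r f x \<le> 1" using r_bound[OF f_int, of x] f_nrm x by simp
    moreover have "1 + 17/20 * e \<le> r f x0" using near_le(1)[OF f_int f_nrm] f_x' x'_norm by linarith
    moreover have "r f x0 = r f x + e * r f y0" by (simp add: x0_def r_add_point r_scale_point f_int)
    ultimately have "e * (17/20) \<le> e * r f y0" by simp
    then show ?thesis using e by simp
  qed
  define D where "D = {m\<in>B. v m \<noteq> 0}"
  have D[measurable]: "D \<in> sets M" and DB: "D \<subseteq> B" by (auto simp: D_def)
  have UD_int: "integrable M (\<lambda>m. (1/t) *\<^sub>R U D m)" using U_int[OF D] by simp
  \<comment> \<open>\<open>g\<close> has the phase of \<open>u\<close>. By the reverse triangle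
    inequality, replacing its modulus on \<open>B\<close> by that of \<open>f\<close> costs at most
    the distance from \<open>f\<close> to \<open>g\<close>.\<close>
  have "nrm (\<lambda>m. g m - (1/t) *\<^sub>R U D m) \<le> nrm (\<lambda>m. f m - g m)"
  proof (rule integral_mono_AE)
    show "integrable M (\<lambda>m. norm (g m - (1/t) *\<^sub>R U D m))" "integrable M (\<lambda>m. norm (f m - g m))"
      using g_int UD_int f_int by auto
    have "AE m in M. g m = norm (g m) *\<^sub>R u m" using u(1) g(1) by (simp add: maximal_phase_def)
    then show "AE m in M. norm (g m - (1/t) *\<^sub>R U D m) \<le> norm (f m - g m)"
    proof eventually_elim
      case (elim m)
      show ?case
      proof (cases "u m = 0")
        case True
        then show ?thesis using elim by (simp add: U_def)
      next
        case False
        then have mB: "m \<in> B" using u_off by (auto simp: B_def)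
        have "norm (v m) = indicator D m"
          using vU mB by (auto simp: D_def unimodular_def split: split_indicator)
        then have fD: "norm (f m) = (1/t) * indicator D m" using t by (simp add: f_def)
        have "norm (g m - (1/t) *\<^sub>R U D m) = norm ((norm (g m) - norm (f m)) *\<^sub>R u m)"
          unfolding fD using elim by (simp add: U_def algebra_simps)
        also have "\<dots> = \<bar>norm (g m) - norm (f m)\<bar>" using u_norm[OF False] by simp
        also have "\<dots> \<le> norm (f m - g m)" by (metis norm_minus_commute norm_triangle_ineq3)
        finally show ?thesis .
      qed
    qed
  qed
  with g(2) have "nrm (\<lambda>m. g m - (1/t) *\<^sub>R U D m) \<le> 1/20" by simp
  then have "nrm (\<lambda>m. g m - (1/t) *\<^sub>R U D m) * norm y0 \<le> 1/20 * 1" using y0 by (intro mult_mono) auto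
  with r_near[OF g_int UD_int, of y0] have 1: "r g y0 \<le> r (\<lambda>m. (1/t) *\<^sub>R U D m) y0 + 1/20" by simp
  have "nrm (\<lambda>m. f m - g m) * norm y0 \<le> 1/20 * 1" using y0 g(2) by (intro mult_mono) auto
  with r_near[OF f_int g_int, of y0] have "r f y0 \<le> r g y0 + 1/20" by simp
  with 1 f_y0 have "3/4 \<le> r (U D) y0 / t" using r_scaleR[OF U_int[OF D], of "1/t" y0] by simp
  then have "3/4 * t \<le> r (U D) y0" using t by (simp add: field_simps)
  \<comment> \<open>The estimate is \<open>3/4 * t \<le> 201/200 * (s/2)\<close>, so
    \<open>t\<close> is at most \<open>0.67 * s\<close>.\<close>
  then have t_le: "t \<le> 7/10 * s" using UE_le[OF D DB] b1 t by simp
  define x'' where "x'' = (1 / norm x') *\<^sub>R x'"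
  have "norm x'' = 1" using x'0 by (simp add: x''_def)
  moreover have "norm (x'' - x) < e0"
  proof -
    have "x'' - x' = (1 / norm x' - 1) *\<^sub>R x'" by (simp add: x''_def algebra_simps)
    then have "norm (x'' - x') = \<bar>1 / norm x' - 1\<bar> * norm x'" by simp
    also have "\<dots> = \<bar>(1 / norm x' - 1) * norm x'\<bar>" by (simp add: abs_mult)
    also have "(1 / norm x' - 1) * norm x' = 1 - norm x'" using x'0 by (simp add: left_diff_distrib)
    also have "\<bar>1 - norm x'\<bar> \<le> norm (x' - x)" using norm_triangle_ineq3[of x' x] x by simp
    finally have "norm (x'' - x') \<le> 2 * e" using dx by simp
    then have "norm (x'' - x) \<le> 4 * e" using dx norm_triangle_ineq[of "x'' - x'" "x' - x"] by simp
    then show ?thesis using e e0 by simp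
  qed
  moreover have "maximal_phase x'' v" unfolding x''_def using v x'0 by (simp add: maximal_phase_scale_point)
  ultimately show ?thesis using v_pos t_le unfolding t_def s_def by blast
qed

text \<open>The starting point of the iteration: a normalised constant on \<open>A\<close> is
  perturbed to a functional that attains its norm and is too close to it to vanish on
  \<open>A\<close>.\<close>

lemma ex_maximal_phase_pos: "\<exists>x u. norm x = 1 \<and> maximal_phase x u \<and> nrm u > 0"
proof -
  obtain b :: 'k where b: "b \<in> Basis" using nonempty_Basis by blast
  define g where "g m = indicator A m *\<^sub>R ((1 / measure M A) *\<^sub>R b)" for m
  have g_meas: "g \<in> borel_measurable M" unfolding g_def[abs_def] by measurable
  have g_norm: "norm (g m) = indicator A m / measure M A" for m
    using b A_pos by (simp add: g_def)
  have g_int: "integrable M g"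
    by (rule integrable_on_A[OF g_meas, of "1 / measure M A"])
      (auto simp: g_norm split: split_indicator, simp add: g_def)
  have g_nrm: "nrm g = 1"
    using A_pos sets.sets_into_space[OF A_sets] by (simp add: g_norm Int_absorb2)
  obtain x0 where x0: "norm x0 \<le> 1" "1 - 1/40 \<le> r g x0"
    using r_almost_norming[OF g_int, of "1/40"] g_nrm by auto
  have "r g x0 \<le> norm x0" using r_bound[OF g_int, of x0] g_nrm by simp
  with x0 have "norm x0 - 1/40 \<le> r g x0" "1/40 < 1/10 * norm x0" by auto
  then obtain x h where x: "x \<noteq> 0" and h: "h \<in> attain_A x" "nrm (\<lambda>m. g m - h m) \<le> 1/10"
    using bishop_phelps_attain_A[OF g_int, of x0 "1/40" "1/10"] g_nrm by (auto simp: g_def)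
  obtain u where u: "maximal_phase x u" using ex_maximal_phase[OF x] by blast
  have "integrable M h" using h by (simp add: attain_A_def attain_def)
  then have "nrm h > 0" using nrm_pos_of_near[OF g_int _] h(2) g_nrm by simp
  then have "nrm u > 0" using maximal_phase_nrm_pos[OF u h(1)] by simp
  moreover have "maximal_phase ((1 / norm x) *\<^sub>R x) u" using u x by (simp add: maximal_phase_scale_point)
  moreover have "norm ((1 / norm x) *\<^sub>R x) = 1" using x by simp
  ultimately show ?thesis by blast
qed

text \<open>Iterating \<open>shrink_maximal_phase\<close> gives a unit vector \<open>x\<close> at which some functional
  supported in \<open>A\<close> attains its norm and is almost supported in sets of arbitrarily small measure.\<close>

lemma contradiction: False
proof -
  obtain z0 w0 where z0: "norm z0 = 1" "maximal_phase z0 w0" "nrm w0 > 0"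
    using ex_maximal_phase_pos by blast
  define K where "K = nrm w0"
  \<comment> \<open>\<open>\<rho>\<close> is an SSD modulus at \<open>x\<close> for the precision
    \<open>(1/2) ^ n\<close>. It is carried along with the point since it must limit all later
    moves.\<close>
  define P where "P n p \<longleftrightarrow> (case p of (x, u, \<rho>) \<Rightarrow>
      norm x = 1 \<and> maximal_phase x u \<and> 0 < nrm u \<and> nrm u \<le> (7/10) ^ n * K \<and> 0 < \<rho> \<and> \<rho> \<le> (1/2) ^ n \<and>
      (\<forall>f. integrable M f \<longrightarrow> (\<forall>m. m \<notin> A \<longrightarrow> f m = 0) \<longrightarrow> nrm f \<le> 1 \<longrightarrow> 1 - \<rho> \<le> r f x \<longrightarrow>
        (\<exists>h\<in>attain_A x. nrm (\<lambda>m. f m - h m) \<le> (1/2) ^ n)))" for n :: nat and p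
  \<comment> \<open>The halvings nest the balls of radius \<open>\<rho>\<close>, so the limit lies
    within \<open>\<rho> n\<close> of every \<open>X n\<close>.\<close>
  define Q where "Q p p' \<longleftrightarrow> (case p of (x, u, \<rho>) \<Rightarrow> case p' of (x', u', \<rho>') \<Rightarrow>
      norm (x' - x) \<le> \<rho> / 2 \<and> \<rho>' \<le> \<rho> / 2)" for p p' :: "'a \<times> ('m \<Rightarrow> 'k) \<times> real"
  have mk: "\<exists>\<rho>. P n (x, u, \<rho>) \<and> \<rho> \<le> c"
    if x: "norm x = 1" "maximal_phase x u" "0 < nrm u" "nrm u \<le> (7/10) ^ n * K" "c > 0" for n x u c
  proof -
    obtain d where d: "d > 0" "\<And>f. \<lbrakk>integrable M f; \<forall>m. m \<notin> A \<longrightarrow> f m = 0; nrm f \<le> 1; 1 - d \<le> r f x\<rbrakk>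
      \<Longrightarrow> \<exists>h\<in>attain_A x. nrm (\<lambda>m. f m - h m) \<le> (1/2) ^ n"
      using SSD_attain_A[OF x(1), of "(1/2) ^ n"] by auto
    have "P n (x, u, min d (min c ((1/2) ^ n)))" using x d by (auto simp: P_def)
    then show ?thesis by force
  qed
  have "\<exists>F. \<forall>n. P n (F n) \<and> Q (F n) (F (Suc n))"
  proof (rule dependent_nat_choice)
    show "\<exists>p. P 0 p" using mk[of z0 w0 0 1] z0 by (auto simp: K_def)
  next
    fix p n assume "P n p"
    then obtain x u \<rho> where p: "p = (x, u, \<rho>)" "P n (x, u, \<rho>)" by (cases p) auto
    then have x: "norm x = 1" "maximal_phase x u" "nrm u > 0" "nrm u \<le> (7/10) ^ n * K" "\<rho> > 0"
      by (auto simp: P_def)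
    then obtain x' u' where x': "norm x' = 1" "norm (x' - x) < \<rho> / 2" "maximal_phase x' u'" "0 < nrm u'"
      "nrm u' \<le> 7/10 * nrm u"
      using shrink_maximal_phase[OF x(1-3), of "\<rho> / 2"] by auto
    have "nrm u' \<le> (7/10) ^ Suc n * K" using x'(5) x(4) by simp
    then obtain \<rho>' where "P (Suc n) (x', u', \<rho>')" "\<rho>' \<le> \<rho> / 2"
      using mk[OF x'(1,3,4), of "Suc n" "\<rho> / 2"] x(5) by auto
    with p(1) x'(2) show "\<exists>p'. P (Suc n) p' \<and> Q p p'"
      by (intro exI[of _ "(x', u', \<rho>')"]) (simp add: Q_def)
  qed
  then obtain F where F: "\<And>n. P n (F n)" "\<And>n. Q (F n) (F (Suc n))" by blast
  define X where "X n = fst (F n)" for n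
  define u where "u n = fst (snd (F n))" for n
  define \<rho> where "\<rho> n = snd (snd (F n))" for n
  have F_eq: "F n = (X n, u n, \<rho> n)" for n by (simp add: X_def u_def \<rho>_def)
  have X1: "norm (X n) = 1" and u_max: "maximal_phase (X n) (u n)" and u_pos: "0 < nrm (u n)"
    and u_small: "nrm (u n) \<le> (7/10) ^ n * K" and \<rho>: "0 < \<rho> n" "\<rho> n \<le> (1/2) ^ n" for n
    using F(1)[of n] unfolding F_eq P_def by auto
  have near: "\<exists>h\<in>attain_A (X n). nrm (\<lambda>m. f m - h m) \<le> (1/2) ^ n"
    if "integrable M f" "\<forall>m. m \<notin> A \<longrightarrow> f m = 0" "nrm f \<le> 1" "1 - \<rho> n \<le> r f (X n)" for f n
    using F(1)[of n] that unfolding F_eq P_def by auto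
  have X_step: "norm (X (Suc n) - X n) \<le> \<rho> n / 2" and \<rho>_step: "\<rho> (Suc n) \<le> \<rho> n / 2" for n
    using F(2)[of n] unfolding F_eq Q_def by auto
  have "\<exists>x. \<Inter>(range (\<lambda>n. cball (X n) (\<rho> n))) = {x}"
  proof (rule decreasing_closed_nest_sing)
    show "cball (X n) (\<rho> n) \<noteq> {}" for n using \<rho>(1)[of n] by auto
    have "cball (X (Suc n)) (\<rho> (Suc n)) \<subseteq> cball (X n) (\<rho> n)" for n
    proof
      fix y assume "y \<in> cball (X (Suc n)) (\<rho> (Suc n))"
      then show "y \<in> cball (X n) (\<rho> n)"
        using dist_triangle[of "X n" y "X (Suc n)"] X_step[of n] \<rho>_step[of n]
        by (simp add: dist_norm norm_minus_commute)
    qed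
    then show "cball (X n) (\<rho> n) \<subseteq> cball (X m) (\<rho> m)" if "m \<le> n" for m n
      using lift_Suc_antimono_le[of "\<lambda>n. cball (X n) (\<rho> n)" m n] that by blast
    fix e :: real assume "e > 0"
    then obtain n where n: "(1/2::real) ^ n < e / 2"
      using real_arch_pow_inv[of "e / 2" "1/2"] by auto
    have "dist y z < e" if "y \<in> cball (X n) (\<rho> n)" "z \<in> cball (X n) (\<rho> n)" for y z
      using that dist_triangle3[of y z "X n"] \<rho>(2)[of n] n by simp
    then show "\<exists>n. \<forall>y\<in>cball (X n) (\<rho> n). \<forall>z\<in>cball (X n) (\<rho> n). dist y z < e" by blast
  qed simp
  then obtain x where "\<Inter>(range (\<lambda>n. cball (X n) (\<rho> n))) = {x}" by blast
  then have "x \<in> cball (X n) (\<rho> n)" for n by blast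
  then have x_near: "norm (X n - x) \<le> \<rho> n" for n by (simp add: dist_norm)
  have \<rho>_lim: "\<rho> \<longlonglongrightarrow> 0"
    by (rule tendsto_sandwich[OF _ _ tendsto_const LIMSEQ_realpow_zero[of "1/2"]])
      (use \<rho> in \<open>auto intro!: always_eventually less_imp_le\<close>)
  have "X \<longlonglongrightarrow> x"
    using Lim_null_comparison[OF _ \<rho>_lim, of "\<lambda>n. X n - x"] x_near by (simp add: LIM_zero_iff)
  from tendsto_norm[OF this] have x1: "norm x = 1" using X1 by (simp add: LIMSEQ_const_iff)
  have r_shift: "r f y - \<rho> n \<le> r f z"
    if "integrable M f" "nrm f = 1" "norm (z - y) \<le> \<rho> n" for f y z n
    using r_abs_bound[OF that(1), of "z - y"] that by (simp add: r_diff_point)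
  \<comment> \<open>The normalised \<open>u n\<close> attains its norm at \<open>X n\<close>, hence
    almost does so at \<open>x\<close>. SSD at \<open>x\<close> puts a member of
    \<open>attain_A x\<close> within \<open>1/2\<close> of it, which is therefore nonzero and can be
    normalised.\<close>
  obtain h where h: "h \<in> attain_A x" "nrm h = 1"
  proof -
    obtain d where d: "d > 0" "\<And>f. \<lbrakk>integrable M f; \<forall>m. m \<notin> A \<longrightarrow> f m = 0; nrm f \<le> 1; 1 - d \<le> r f x\<rbrakk>
      \<Longrightarrow> \<exists>h\<in>attain_A x. nrm (\<lambda>m. f m - h m) \<le> 1/2"
      using SSD_attain_A[OF x1, of "1/2"] by auto
    obtain n where n: "\<rho> n < d" using order_tendstoD(2)[OF \<rho>_lim d(1)] by (auto simp: eventually_sequentially)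
    define f where "f m = (1 / nrm (u n)) *\<^sub>R u n m" for m
    have uN: "u n \<in> attain_A (X n)" using u_max[of n] by (simp add: maximal_phase_def)
    have u_int: "integrable M (u n)" using uN by (simp add: attain_A_def attain_def)
    have f_int: "integrable M f" unfolding f_def[abs_def] using u_int by simp
    have f_nrm: "nrm f = 1" using u_pos[of n] by (simp add: f_def)
    have "r f (X n) = 1"
      using r_scaleR[OF u_int, of "1 / nrm (u n)" "X n"] uN X1[of n] u_pos[of n]
      by (simp add: f_def[abs_def] attain_A_def attain_def)
    then have "1 - d \<le> r f x"
      using r_shift[OF f_int f_nrm, of x "X n" n] x_near[of n] n by (simp add: norm_minus_commute)
    moreover have "\<forall>m. m \<notin> A \<longrightarrow> f m = 0" using uN by (simp add: f_def attain_A_def)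
    ultimately obtain h where h: "h \<in> attain_A x" "nrm (\<lambda>m. f m - h m) \<le> 1/2"
      using d(2)[OF f_int] f_nrm by auto
    have "integrable M h" using h by (simp add: attain_A_def attain_def)
    then have h_pos: "nrm h > 0" using nrm_pos_of_near[OF f_int _] h(2) f_nrm by simp
    have "(\<lambda>m. (1 / nrm h) *\<^sub>R h m) \<in> attain_A x"
      using h(1) attain_scaleR[of h x "1 / nrm h"] by (simp add: attain_A_def)
    moreover have "nrm (\<lambda>m. (1 / nrm h) *\<^sub>R h m) = 1" using h_pos by simp
    ultimately show ?thesis using that by blast
  qed
  have h_int: "integrable M h" using h by (simp add: attain_A_def attain_def)
  have h_x: "r h x = 1" using h x1 by (simp add: attain_A_def attain_def)
  have h_off: "\<forall>m. m \<notin> A \<longrightarrow> h m = 0" using h(1) by (simp add: attain_A_def)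
  note [measurable] = borel_measurable_integrable[OF h_int]
  have u_meas[measurable]: "u n \<in> borel_measurable M" for n
    using u_max[of n] by (auto simp: maximal_phase_def attain_A_def attain_def)
  define E where "E n = {m\<in>A. u n m \<noteq> 0}" for n
  have E[measurable]: "E n \<in> sets M" for n unfolding E_def by measurable
  have E_measure: "measure M (E n) \<le> (7/10) ^ n * K" for n
    using unimodular_nrm[OF u_meas, of n] u_max[of n] u_small[of n]
    by (auto simp: E_def maximal_phase_def attain_A_def)
  \<comment> \<open>Conversely \<open>h\<close> is almost norming at \<open>X n\<close>, up to
    \<open>\<rho> n\<close>. SSD at \<open>X n\<close> places it within \<open>(1/2) ^ n\<close> of
    a function that vanishes almost everywhere off \<open>E n\<close>.\<close>
  have ge: "1 - (1/2) ^ n \<le> (\<integral>m. indicator (E n) m * norm (h m) \<partial>M)" for n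
  proof -
    have "1 - \<rho> n \<le> r h (X n)" using r_shift[OF h_int h(2), of "X n" x n] x_near[of n] h_x by simp
    then obtain g where g: "g \<in> attain_A (X n)" "nrm (\<lambda>m. h m - g m) \<le> (1/2) ^ n"
      using near[OF h_int h_off] h(2) by auto
    have g_int: "integrable M g" using g by (simp add: attain_A_def attain_def)
    have i1: "integrable M (\<lambda>m. indicator (E n) m * norm (h m))"
      using integrable_mult_indicator[OF E[of n] integrable_norm[OF h_int]] by simp
    have i2: "integrable M (\<lambda>m. norm (h m - g m))" using h_int g_int by auto
    have "nrm h \<le> (\<integral>m. indicator (E n) m * norm (h m) + norm (h m - g m) \<partial>M)"
    proof (rule integral_mono_AE)
      have "AE m in M. g m = norm (g m) *\<^sub>R u n m" using u_max[of n] g(1) by (simp add: maximal_phase_def)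
      then show "AE m in M. norm (h m) \<le> indicator (E n) m * norm (h m) + norm (h m - g m)"
      proof eventually_elim
        case (elim m)
        show ?case
        proof (cases "m \<in> E n")
          case False
          then have "g m = 0" using elim g(1) by (cases "m \<in> A") (auto simp: E_def attain_A_def)
          then show ?thesis by (auto split: split_indicator)
        qed simp
      qed
    qed (use h_int i1 i2 in auto)
    also have "\<dots> = (\<integral>m. indicator (E n) m * norm (h m) \<partial>M) + nrm (\<lambda>m. h m - g m)"
      using i1 i2 by (rule Bochner_Integration.integral_add)
    finally show ?thesis using h(2) g(2) by simp
  qed
  \<comment> \<open>By the Borel-Cantelli lemma almost every point lies in only finitely many
    \<open>E n\<close>. Dominated convergence then sends the integrals in \<open>ge\<close> to 0,
    although their lower bounds tend to 1.\<close>
  have "summable (\<lambda>n. measure M (E n))"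
  proof (rule summable_comparison_test')
    show "summable (\<lambda>n. (7/10) ^ n * K)" by (intro summable_mult2 summable_geometric) simp
    show "norm (measure M (E n)) \<le> (7/10) ^ n * K" if "n \<ge> 0" for n using E_measure[of n] by simp
  qed
  moreover have "emeasure M (E n) < \<infinity>" for n by (rule emeasure_A_finite) (auto simp: E_def)
  ultimately have "AE m in M. \<forall>\<^sub>F n in sequentially. m \<in> space M - E n"
    by (intro borel_cantelli_AE1) auto
  then have "AE m in M. (\<lambda>n. indicator (E n) m * norm (h m)) \<longlonglongrightarrow> 0"
  proof eventually_elim
    case (elim m)
    then show ?case by (intro tendsto_eventually) (auto elim: eventually_mono)
  qed
  then have "(\<lambda>n. \<integral>m. indicator (E n) m * norm (h m) \<partial>M) \<longlonglongrightarrow> (\<integral>m. 0 \<partial>M)"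
    by (intro integral_dominated_convergence[where w="\<lambda>m. norm (h m)"])
      (use h_int in \<open>auto split: split_indicator\<close>)
  moreover have "(\<lambda>n. 1 - (1/2::real) ^ n) \<longlonglongrightarrow> 1 - 0"
    by (intro tendsto_diff tendsto_const LIMSEQ_realpow_zero) auto
  ultimately have "1 - 0 \<le> (\<integral>m. 0 \<partial>M :: real)"
    using ge by (intro LIMSEQ_le) auto
  then show False by simp
qed

end

text \<open>If \<open>A\<close> contains no atom, every part of \<open>A\<close> of positive measure
  has a subset of strictly intermediate measure, which is the excluded diffuse situation.\<close>

lemma (in L1_pairing) SSD_imp_atom:
  assumes ssd: "\<And>x :: 'a. norm x = 1 \<Longrightarrow> SSD_at x"
    and A: "A \<in> sets M" "emeasure M A < \<infinity>" "0 < measure M A"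
  shows "\<exists>B\<in>sets M. B \<subseteq> A \<and> 0 < measure M B \<and>
    (\<forall>C\<in>sets M. C \<subseteq> B \<longrightarrow> measure M C = 0 \<or> measure M C = measure M B)"
proof (rule ccontr)
  assume neg: "\<not> ?thesis"
  have "diffuse_L1_pairing M r A"
  proof unfold_locales
    fix B assume B: "B \<in> sets M" "B \<subseteq> A" "0 < measure M B"
    then obtain C where C: "C \<in> sets M" "C \<subseteq> B" "measure M C \<noteq> 0" "measure M C \<noteq> measure M B"
      using neg by blast
    have "B \<in> fmeasurable M"
      using A B emeasure_mono[of B A M] by (auto simp: fmeasurable_def)
    then have "measure M C \<le> measure M B" using C by (intro measure_mono_fmeasurable) auto
    with C show "\<exists>C\<in>sets M. C \<subseteq> B \<and> 0 < measure M C \<and> measure M C < measure M B"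
      by (intro bexI[of _ C]) (auto simp: zero_less_measure_iff less_le)
  qed (use A ssd in auto)
  then show False by (rule diffuse_L1_pairing.contradiction)
qed

section \<open>Preduals of \<open>L\<^sup>1\<close> over the real or complex scalars\<close>

text \<open>Both scalar fields are covered by \<open>'k\<close>; \<open>re\<close> is the real part and
  \<open>extend\<close> says that a real functional is the real part of a \<open>'k\<close>-linear one.\<close>

locale predual_of_L1 = normed_space_over smul
  for smul :: "'k::{real_normed_field, euclidean_space} \<Rightarrow> 'a::banach \<Rightarrow> 'a" +
  fixes M :: "'m measure" and re :: "'k \<Rightarrow> real" and T :: "('a \<Rightarrow> 'k) \<Rightarrow> ('m \<Rightarrow> 'k) set"
  assumes T_bij: "bij_betw T (vecs (dual_space smul)) (vecs (L1_space M))"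
    and T_add: "\<And>u v. \<lbrakk>u \<in> vecs (dual_space smul); v \<in> vecs (dual_space smul)\<rbrakk> \<Longrightarrow>
      T (vadd (dual_space smul) u v) = vadd (L1_space M) (T u) (T v)"
    and T_scale: "\<And>c v. v \<in> vecs (dual_space smul) \<Longrightarrow>
      T (vscale (dual_space smul) c v) = vscale (L1_space M) c (T v)"
    and T_norm: "\<And>v. v \<in> vecs (dual_space smul) \<Longrightarrow> vnorm (L1_space M) (T v) = vnorm (dual_space smul) v"
    and re_add: "re (a + b) = re a + re b"
    and re_scale: "re (of_real t * a) = t * re a"
    and re_le: "re a \<le> norm a"
    and re_of_real: "re (of_real t) = t"
    and extend: "\<And>l :: 'a \<Rightarrow> real. \<lbrakk>linear l; \<And>y. l y \<le> norm y\<rbrakk> \<Longrightarrow>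
      \<exists>F. Vector_Spaces.linear smul (*) F \<and> (\<forall>x. re (F x) = l x)"
begin

abbreviation dual :: "('a \<Rightarrow> 'k) set" where "dual \<equiv> vecs (dual_space smul)"

lemma dual_iff: "F \<in> dual \<longleftrightarrow> Vector_Spaces.linear smul (*) F \<and> (\<exists>K. \<forall>x. norm (F x) \<le> norm x * K)"
  by (simp add: dual_space_def)

lemma dual_add: "F \<in> dual \<Longrightarrow> F (x + y) = F x + F y"
  by (simp add: dual_iff Vector_Spaces.linear_iff)

lemma dual_scale: "F \<in> dual \<Longrightarrow> F (smul c x) = c * F x"
  by (simp add: dual_iff Vector_Spaces.linear_iff)

lemma dualI:
  assumes "\<And>x y. F (x + y) = F x + F y" "\<And>c x. F (smul c x) = c * F x" "\<And>x. norm (F x) \<le> K * norm x"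
  shows "F \<in> dual"
proof -
  have "Vector_Spaces.linear smul (*) F"
    using assms(1,2) normed_space_over.axioms(1)[OF normed_space_over_mult] vector_space_axioms
    by (simp add: Vector_Spaces.linear_iff)
  moreover have "\<forall>x. norm (F x) \<le> norm x * K" using assms(3) by (simp add: mult.commute)
  ultimately show ?thesis unfolding dual_iff by blast
qed

lemma dual_scaleR: "F \<in> dual \<Longrightarrow> F (c *\<^sub>R x) = c *\<^sub>R F x"
  using dual_scale[of F "of_real c" x] by (simp add: scale_of_real scaleR_conv_of_real)

lemma dual_bounded_linear: "F \<in> dual \<Longrightarrow> bounded_linear F"
  using dual_iff[of F] by (auto intro!: bounded_linear_intro simp: dual_add dual_scaleR)

lemma dual_onorm: "F \<in> dual \<Longrightarrow> norm (F x) \<le> onorm F * norm x"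
  by (rule onorm[OF dual_bounded_linear])

text \<open>Multiplying the point by a scalar of modulus 1 makes \<open>F x\<close> a nonnegative
  real, so a bound on the real part bounds the modulus.\<close>

lemma dual_onorm_le:
  assumes F: "F \<in> dual" and K: "0 \<le> K" "\<And>x. re (F x) \<le> K * norm x"
  shows "onorm F \<le> K"
proof (rule onorm_bound[OF K(1)])
  fix x
  show "norm (F x) \<le> K * norm x"
  proof (cases "F x = 0")
    case True then show ?thesis using K(1) by simp
  next
    case False
    define c where "c = of_real (norm (F x)) / F x"
    have "norm c = 1" using False by (simp add: c_def norm_divide)
    moreover have "F (smul c x) = of_real (norm (F x))" using False by (simp add: dual_scale[OF F] c_def)
    ultimately show ?thesis using K(2)[of "smul c x"] by (simp add: re_of_real norm_scale)
  qed
qed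

lemma ex_dual_of_real_functional:
  assumes l: "linear l" "\<And>y. l y \<le> norm y"
  shows "\<exists>F\<in>dual. \<forall>x. re (F x) = l x"
proof -
  obtain F where F: "Vector_Spaces.linear smul (*) F" "\<And>x. re (F x) = l x" using extend[OF l] by blast
  have sc: "F (smul c x) = c * F x" for c x
    using F(1) by (simp add: Vector_Spaces.linear_iff)
  have "norm (F x) \<le> norm x * 1" for x
  proof (cases "F x = 0")
    case False
    define c where "c = of_real (norm (F x)) / F x"
    have "norm c = 1" using False by (simp add: c_def norm_divide)
    moreover have "F (smul c x) = of_real (norm (F x))" using False by (simp add: sc c_def)
    ultimately show ?thesis using F(2)[of "smul c x"] l(2)[of "smul c x"] by (simp add: re_of_real norm_scale)
  qed simp
  then have "F \<in> dual" using F(1) unfolding dual_iff by blast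
  with F(2) show ?thesis by blast
qed

lemma L1_class_cong: "AE m in M. f m = g m \<Longrightarrow> L1_class M f = L1_class M g"
  unfolding L1_class_def by (auto elim: AE_mp eventually_mono simp: eventually_conj_iff)

text \<open>The inverse of \<open>T\<close>, read on representatives. It is meaningful for
  integrable \<open>f\<close> and depends only on the class of \<open>f\<close>.\<close>

definition S :: "('m \<Rightarrow> 'k) \<Rightarrow> 'a \<Rightarrow> 'k" where
  "S f = inv_into dual T (L1_class M f)"

lemma vecs_L1: "integrable M f \<Longrightarrow> L1_class M f \<in> vecs (L1_space M)"
  by (simp add: L1_space_def)

lemma S_dual: "integrable M f \<Longrightarrow> S f \<in> dual"
  unfolding S_def using bij_betw_imp_surj_on[OF T_bij] vecs_L1 by (intro inv_into_into) simp

lemma T_S: "integrable M f \<Longrightarrow> T (S f) = L1_class M f"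
  unfolding S_def using bij_betw_imp_surj_on[OF T_bij] vecs_L1[of f] f_inv_into_f[of "L1_class M f" T dual]
  by simp

lemma S_eqI: "integrable M f \<Longrightarrow> F \<in> dual \<Longrightarrow> T F = L1_class M f \<Longrightarrow> S f = F"
  using inj_onD[OF bij_betw_imp_inj_on[OF T_bij], of "S f" F] by (simp add: S_dual T_S)

lemma S_add:
  assumes "integrable M f" "integrable M g"
  shows "S (\<lambda>m. f m + g m) = (\<lambda>x. S f x + S g x)"
proof (rule S_eqI)
  have "(\<lambda>x. S f x + S g x) = vadd (dual_space smul) (S f) (S g)" by (simp add: dual_space_def)
  then show "T (\<lambda>x. S f x + S g x) = L1_class M (\<lambda>m. f m + g m)"
    using assms by (simp add: T_add S_dual T_S vadd_L1_class)
  have "norm (S f x + S g x) \<le> (onorm (S f) + onorm (S g)) * norm x" for x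
    using norm_triangle_ineq[of "S f x" "S g x"] dual_onorm[OF S_dual, of f x] dual_onorm[OF S_dual, of g x] assms
    by (simp add: distrib_right)
  then show "(\<lambda>x. S f x + S g x) \<in> dual"
    using assms by (intro dualI) (simp_all add: dual_add dual_scale S_dual distrib_left)
qed (use assms in auto)

lemma S_scale:
  assumes "integrable M f"
  shows "S (\<lambda>m. c * f m) = (\<lambda>x. c * S f x)"
proof (rule S_eqI)
  have "(\<lambda>x. c * S f x) = vscale (dual_space smul) c (S f)" by (simp add: dual_space_def)
  then show "T (\<lambda>x. c * S f x) = L1_class M (\<lambda>m. c * f m)"
    using assms by (simp add: T_scale S_dual T_S vscale_L1_class)
  have "norm (c * S f x) \<le> (norm c * onorm (S f)) * norm x" for x
    using mult_left_mono[OF dual_onorm[OF S_dual, of f x], of "norm c"] assms by (simp add: norm_mult mult.assoc)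
  then show "(\<lambda>x. c * S f x) \<in> dual"
    using assms by (intro dualI) (simp_all add: dual_add dual_scale S_dual distrib_left)
qed (use assms in auto)

lemma S_norm: "integrable M f \<Longrightarrow> onorm (S f) = (\<integral>m. norm (f m) \<partial>M)"
  using T_norm[OF S_dual, of f] by (simp add: T_S vnorm_L1_class) (simp add: dual_space_def)

lemma S_surj:
  assumes "F \<in> dual"
  shows "\<exists>f. integrable M f \<and> S f = F"
proof -
  have "T F \<in> vecs (L1_space M)" using bij_betwE[OF T_bij] assms by blast
  then obtain f where "integrable M f" "T F = L1_class M f" by (auto simp: L1_space_def)
  with S_eqI[OF _ assms] show ?thesis by blast
qed

lemma S_cong_AE:
  assumes "integrable M f" "integrable M g" "AE m in M. f m = g m"
  shows "S f = S g"
  unfolding S_def using L1_class_cong[OF assms(3)] by simp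

lemma S_inj:
  assumes "integrable M f" "integrable M g" "S f = S g"
  shows "AE m in M. f m = g m"
proof -
  have "L1_class M f = L1_class M g" using assms T_S by metis
  then show ?thesis using L1_class_self[OF assms(1)] by (auto simp: L1_class_def)
qed

definition r :: "('m \<Rightarrow> 'k) \<Rightarrow> 'a \<Rightarrow> real" where "r f x = re (S f x)"

sublocale L1_pairing M r
proof (rule L1_pairing.intro)
  show "r (\<lambda>m. f m + g m) x = r f x + r g x" if "integrable M f" "integrable M g" for f g x
    using that by (simp add: r_def S_add re_add)
  show "r (\<lambda>m. c *\<^sub>R f m) x = c * r f x" if "integrable M f" for f c x
    using that by (simp add: r_def scaleR_conv_of_real S_scale re_scale)
  show "linear (r f)" if "integrable M f" for f
    using that by (intro linearI) (simp_all add: r_def dual_add dual_scaleR S_dual re_add scaleR_conv_of_real re_scale)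
  show "r f x \<le> (\<integral>m. norm (f m) \<partial>M) * norm x" if "integrable M f" for f x
    using re_le[of "S f x"] dual_onorm[OF S_dual[OF that], of x] by (simp add: r_def S_norm[OF that])
  show "(\<integral>m. norm (f m) \<partial>M) \<le> K" if "integrable M f" "0 \<le> K" "\<And>y. r f y \<le> K * norm y" for f K
    using dual_onorm_le[OF S_dual[OF that(1)] that(2)] that(3) by (simp add: r_def S_norm[OF that(1)])
next
  fix l :: "'a \<Rightarrow> real" assume l: "linear l" "\<And>y. l y \<le> norm y"
  obtain F where F: "F \<in> dual" "\<forall>x. re (F x) = l x" using ex_dual_of_real_functional[OF l] by blast
  then show "\<exists>f. integrable M f \<and> r f = l" using S_surj[OF F(1)] by (auto simp: r_def fun_eq_iff)
qed

section \<open>Atoms and the map from \<open>\<ell>\<^sup>1(\<Gamma>)\<close> into the dual\<close>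

definition atom :: "'m set \<Rightarrow> bool" where
  "atom C \<longleftrightarrow> C \<in> sets M \<and> emeasure M C < \<infinity> \<and> 0 < measure M C \<and>
    (\<forall>D\<in>sets M. D \<subseteq> C \<longrightarrow> measure M D = 0 \<or> measure M D = measure M C)"

definition uniform :: "'m set \<Rightarrow> 'm \<Rightarrow> 'k" where
  "uniform C m = of_real (indicator C m / measure M C)"

text \<open>Indexing by functionals instead of sets identifies atoms that differ by a null
  set.\<close>

definition \<Gamma> :: "('a \<Rightarrow> 'k) set" where "\<Gamma> = (\<lambda>C. S (uniform C)) ` Collect atom"

definition rep :: "('a \<Rightarrow> 'k) \<Rightarrow> 'm set" where "rep \<gamma> = (SOME C. atom C \<and> S (uniform C) = \<gamma>)"

definition coef :: "'m set \<Rightarrow> ('m \<Rightarrow> 'k) \<Rightarrow> 'k" where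
  "coef C f = (\<integral>m. indicator C m *\<^sub>R f m \<partial>M)"

text \<open>This is the inverse of the isometry sought. SSD enters only in showing that it is
  onto.\<close>

definition J :: "(('a \<Rightarrow> 'k) \<Rightarrow> 'k) \<Rightarrow> 'a \<Rightarrow> 'k" where "J b x = (\<Sum>\<^sub>\<infinity>\<gamma>\<in>\<Gamma>. b \<gamma> * \<gamma> x)"

abbreviation ell1 :: "(('a \<Rightarrow> 'k) \<Rightarrow> 'k) set" where "ell1 \<equiv> vecs (ell1_space \<Gamma>)"

lemma ell1_iff: "b \<in> ell1 \<longleftrightarrow> (\<forall>i. i \<notin> \<Gamma> \<longrightarrow> b i = 0) \<and> (\<lambda>i. norm (b i)) summable_on \<Gamma>"
  by (simp add: ell1_space_def)

lemma rep: "\<gamma> \<in> \<Gamma> \<Longrightarrow> atom (rep \<gamma>)" "\<gamma> \<in> \<Gamma> \<Longrightarrow> S (uniform (rep \<gamma>)) = \<gamma>"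
  using someI_ex[of "\<lambda>C. atom C \<and> S (uniform C) = \<gamma>"] by (auto simp: \<Gamma>_def rep_def)

lemma uniform_integrable: "atom C \<Longrightarrow> integrable M (uniform C)"
  unfolding uniform_def[abs_def] atom_def by (intro integrable_of_real) auto

lemma uniform_nrm: "atom C \<Longrightarrow> nrm (uniform C) = 1"
  using sets.sets_into_space[of C M] by (simp add: uniform_def atom_def Int_absorb2 norm_divide)

lemma \<Gamma>_dual: "\<gamma> \<in> \<Gamma> \<Longrightarrow> \<gamma> \<in> dual"
  by (auto simp: \<Gamma>_def intro!: S_dual uniform_integrable)

lemma \<Gamma>_le: "\<gamma> \<in> \<Gamma> \<Longrightarrow> norm (\<gamma> x) \<le> norm x"
  using dual_onorm[OF \<Gamma>_dual, of \<gamma> x] by (auto simp: \<Gamma>_def S_norm uniform_integrable uniform_nrm)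

text \<open>\<open>measure\<close> is 0 on sets of infinite measure as well; the superset
  \<open>X\<close> of finite measure rules that case out.\<close>

lemma finite_measure_zero_null:
  assumes "X \<in> sets M" "emeasure M X < \<infinity>" "D \<in> sets M" "D \<subseteq> X" "measure M D = 0"
  shows "D \<in> null_sets M"
proof -
  have "emeasure M D \<noteq> top" using emeasure_mono[OF assms(4,1)] assms(2) by (auto simp: top_unique)
  then have "emeasure M D = ennreal (measure M D)" by (rule emeasure_eq_ennreal_measure)
  with assms show ?thesis by (auto intro: null_setsI)
qed

text \<open>An intersection of nonzero measure must have the full measure of both atoms, so both
  differences are null.\<close>

lemma atoms_overlap_AE_eq:
  assumes "atom C" "atom D" "measure M (C \<inter> D) \<noteq> 0"
  shows "AE m in M. m \<in> C \<longleftrightarrow> m \<in> D" "measure M C = measure M D"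
proof -
  have CD: "C \<in> sets M" "D \<in> sets M" "emeasure M C < \<infinity>" "emeasure M D < \<infinity>"
    using assms(1,2) unfolding atom_def by blast+
  have "C \<inter> D \<in> sets M" using CD by (intro sets.Int)
  with assms have eq: "measure M (C \<inter> D) = measure M C" "measure M (C \<inter> D) = measure M D"
    unfolding atom_def by blast+
  then show "measure M C = measure M D" by (rule trans[OF sym])
  have diff: "X - Y \<in> null_sets M"
    if X: "X \<in> sets M" "Y \<in> sets M" "emeasure M X < \<infinity>" "measure M (X \<inter> Y) = measure M X" for X Y
  proof -
    have "measure M (X - X \<inter> Y) = measure M X - measure M (X \<inter> Y)"
      using X by (intro measure_Diff) auto
    with X have "measure M (X - Y) = 0" by (simp add: Diff_Int)
    then show ?thesis using X by (intro finite_measure_zero_null[of X]) auto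
  qed
  have "measure M (D \<inter> C) = measure M D" unfolding Int_commute[of D C] by (rule eq(2))
  then have "C - D \<in> null_sets M" "D - C \<in> null_sets M"
    using diff[OF CD(1,2,3) eq(1)] diff[OF CD(2,1,4)] by blast+
  from this[THEN AE_not_in] have "AE m in M. m \<notin> C - D" "AE m in M. m \<notin> D - C" .
  then show "AE m in M. m \<in> C \<longleftrightarrow> m \<in> D" by eventually_elim auto
qed

lemma rep_disjoint:
  assumes "\<gamma> \<in> \<Gamma>" "\<delta> \<in> \<Gamma>" "\<gamma> \<noteq> \<delta>"
  shows "AE m in M. \<not> (m \<in> rep \<gamma> \<and> m \<in> rep \<delta>)"
proof -
  note a = rep(1)[OF assms(1)] rep(1)[OF assms(2)]
  have "measure M (rep \<gamma> \<inter> rep \<delta>) = 0"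
  proof (rule ccontr)
    assume "\<not> ?thesis"
    note eq = atoms_overlap_AE_eq[OF a this]
    have "S (uniform (rep \<gamma>)) = S (uniform (rep \<delta>))"
      by (intro S_cong_AE uniform_integrable a, use eq(1) in eventually_elim)
        (simp add: uniform_def eq(2) indicator_def)
    with assms show False by (simp add: rep(2))
  qed
  then have "rep \<gamma> \<inter> rep \<delta> \<in> null_sets M"
    using a by (intro finite_measure_zero_null[of "rep \<gamma>"]) (auto simp: atom_def)
  then show ?thesis using AE_not_in by fastforce
qed

lemma coef_diff: "\<lbrakk>C \<in> sets M; integrable M f; integrable M g\<rbrakk> \<Longrightarrow> coef C (\<lambda>m. f m - g m) = coef C f - coef C g"
  unfolding coef_def using integrable_mult_indicator[of C M f] integrable_mult_indicator[of C M g]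
  by (simp add: scaleR_diff_right)

lemma coef_mult: "coef C (\<lambda>m. c * f m) = c * coef C f"
  by (simp add: coef_def mult_scaleR_right[symmetric] del: mult_scaleR_right)

lemma coef_norm_le: "\<lbrakk>C \<in> sets M; integrable M f\<rbrakk> \<Longrightarrow> norm (coef C f) \<le> (\<integral>m. indicator C m * norm (f m) \<partial>M)"
  unfolding coef_def using integral_norm_bound[of M "\<lambda>m. indicator C m *\<^sub>R f m"] by simp

lemma coef_norm_le_nrm:
  assumes "C \<in> sets M" "integrable M f"
  shows "norm (coef C f) \<le> nrm f"
proof -
  have "norm (coef C f) \<le> (\<integral>m. indicator C m * norm (f m) \<partial>M)" by (rule coef_norm_le[OF assms])
  also have "\<dots> \<le> nrm f"
    using assms integrable_mult_indicator[OF assms(1) integrable_norm[OF assms(2)]]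
    by (intro integral_mono) (auto split: split_indicator)
  finally show ?thesis .
qed

text \<open>The chosen atoms are disjoint up to null sets, so their integrals of
  \<open>norm (f m)\<close> do not overlap. With \<open>F\<close> finite the exceptional sets still
  unite to a null set, even if \<open>\<Gamma>\<close> is uncountable.\<close>

lemma sum_coef_le:
  assumes F: "finite F" "F \<subseteq> \<Gamma>" and f: "integrable M f"
  shows "(\<Sum>\<gamma>\<in>F. norm (coef (rep \<gamma>) f)) \<le> nrm f"
proof -
  have rep_sets: "rep \<gamma> \<in> sets M" if "\<gamma> \<in> F" for \<gamma> using that F rep(1) by (auto simp: atom_def)
  have i: "integrable M (\<lambda>m. indicator (rep \<gamma>) m * norm (f m))" if "\<gamma> \<in> F" for \<gamma>
    using integrable_mult_indicator[OF rep_sets[OF that] integrable_norm[OF f]] by simp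
  have "(\<Sum>\<gamma>\<in>F. norm (coef (rep \<gamma>) f)) \<le> (\<Sum>\<gamma>\<in>F. \<integral>m. indicator (rep \<gamma>) m * norm (f m) \<partial>M)"
    by (intro sum_mono coef_norm_le rep_sets f)
  also have "\<dots> = (\<integral>m. (\<Sum>\<gamma>\<in>F. indicator (rep \<gamma>) m * norm (f m)) \<partial>M)"
    using i by (simp add: Bochner_Integration.integral_sum)
  also have "\<dots> \<le> nrm f"
  proof (rule integral_mono_AE)
    have "AE m in M. \<forall>\<gamma>\<in>F. \<forall>\<delta>\<in>F. \<gamma> \<noteq> \<delta> \<longrightarrow> \<not> (m \<in> rep \<gamma> \<and> m \<in> rep \<delta>)"
    proof (intro AE_finite_allI F(1))
      fix \<gamma> \<delta> assume "\<gamma> \<in> F" "\<delta> \<in> F"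
      then show "AE m in M. \<gamma> \<noteq> \<delta> \<longrightarrow> \<not> (m \<in> rep \<gamma> \<and> m \<in> rep \<delta>)"
        using F rep_disjoint[of \<gamma> \<delta>] by (cases "\<gamma> = \<delta>") (simp_all add: subset_iff)
    qed
    then show "AE m in M. (\<Sum>\<gamma>\<in>F. indicator (rep \<gamma>) m * norm (f m)) \<le> norm (f m)"
    proof eventually_elim
      case (elim m)
      show ?case
      proof (cases "\<exists>\<delta>\<in>F. m \<in> rep \<delta>")
        case True
        then obtain \<delta> where d: "\<delta> \<in> F" "m \<in> rep \<delta>" by blast
        have "(\<Sum>\<gamma>\<in>F. indicator (rep \<gamma>) m * norm (f m)) = (\<Sum>\<gamma>\<in>F. if \<gamma> = \<delta> then norm (f m) else 0)"
          using elim d by (intro sum.cong) (auto split: split_indicator)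
        also have "\<dots> = norm (f m)" using d F by (simp add: sum.delta)
        finally show ?thesis by simp
      next
        case False
        then have "(\<Sum>\<gamma>\<in>F. indicator (rep \<gamma>) m * norm (f m)) = 0" by (intro sum.neutral) auto
        then show ?thesis by simp
      qed
    qed
    show "integrable M (\<lambda>m. \<Sum>\<gamma>\<in>F. indicator (rep \<gamma>) m * norm (f m))" by (intro Bochner_Integration.integrable_sum i)
  qed (use f in auto)
  finally show ?thesis .
qed

lemma coef_uniform:
  assumes "\<gamma> \<in> \<Gamma>" "\<delta> \<in> \<Gamma>"
  shows "coef (rep \<gamma>) (uniform (rep \<delta>)) = (if \<gamma> = \<delta> then 1 else 0)"
proof (cases "\<gamma> = \<delta>")
  case True
  have a: "atom (rep \<gamma>)" using rep(1) assms by blast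
  have "indicator (rep \<gamma>) m *\<^sub>R uniform (rep \<gamma>) m = (indicator (rep \<gamma>) m / measure M (rep \<gamma>)) *\<^sub>R (1 :: 'k)" for m
    by (auto simp: uniform_def scaleR_conv_of_real split: split_indicator)
  then have "coef (rep \<gamma>) (uniform (rep \<gamma>)) = (\<integral>m. (indicator (rep \<gamma>) m / measure M (rep \<gamma>)) *\<^sub>R (1 :: 'k) \<partial>M)"
    by (simp only: coef_def)
  also have "\<dots> = (\<integral>m. indicator (rep \<gamma>) m / measure M (rep \<gamma>) \<partial>M) *\<^sub>R 1"
    using a by (intro integral_scaleR_left) (auto simp: atom_def)
  also have "\<dots> = 1"
    using a sets.sets_into_space[of "rep \<gamma>" M] by (simp add: atom_def Int_absorb2)
  finally show ?thesis using True by simp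
next
  case False
  have "AE m in M. indicator (rep \<gamma>) m *\<^sub>R uniform (rep \<delta>) m = 0"
    using rep_disjoint[OF assms False] by eventually_elim (auto simp: uniform_def split: split_indicator)
  then show ?thesis using False unfolding coef_def by (simp add: integral_eq_zero_AE)
qed

lemma J_abs_summable:
  assumes "b \<in> ell1" "A \<subseteq> \<Gamma>"
  shows "(\<lambda>\<gamma>. norm (b \<gamma> * \<gamma> x)) summable_on A" "(\<lambda>\<gamma>. norm (b \<gamma>)) summable_on A"
    "norm (\<Sum>\<^sub>\<infinity>\<gamma>\<in>A. b \<gamma> * \<gamma> x) \<le> (\<Sum>\<^sub>\<infinity>\<gamma>\<in>A. norm (b \<gamma>)) * norm x"
proof -
  show b: "(\<lambda>\<gamma>. norm (b \<gamma>)) summable_on A"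
    using assms by (auto simp: ell1_iff intro: summable_on_subset_banach)
  have le: "norm (b \<gamma> * \<gamma> x) \<le> norm (b \<gamma>) * norm x" if "\<gamma> \<in> A" for \<gamma>
    using that assms \<Gamma>_le by (auto simp: norm_mult intro!: mult_left_mono)
  show abs: "(\<lambda>\<gamma>. norm (b \<gamma> * \<gamma> x)) summable_on A"
    by (rule Infinite_Sum.abs_summable_on_comparison_test'[OF summable_on_cmult_left[OF b] le])
  have "norm (\<Sum>\<^sub>\<infinity>\<gamma>\<in>A. b \<gamma> * \<gamma> x) \<le> (\<Sum>\<^sub>\<infinity>\<gamma>\<in>A. norm (b \<gamma> * \<gamma> x))" by (rule norm_infsum_bound[OF abs])
  also have "\<dots> \<le> (\<Sum>\<^sub>\<infinity>\<gamma>\<in>A. norm (b \<gamma>) * norm x)"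
    by (rule infsum_mono[OF abs summable_on_cmult_left[OF b] le])
  finally show "norm (\<Sum>\<^sub>\<infinity>\<gamma>\<in>A. b \<gamma> * \<gamma> x) \<le> (\<Sum>\<^sub>\<infinity>\<gamma>\<in>A. norm (b \<gamma>)) * norm x"
    by (simp add: infsum_cmult_left')
qed

lemma J_summable: "b \<in> ell1 \<Longrightarrow> (\<lambda>\<gamma>. b \<gamma> * \<gamma> x) summable_on \<Gamma>"
  by (rule Infinite_Sum.abs_summable_summable[OF J_abs_summable(1)]) auto

lemma J_dual:
  assumes b: "b \<in> ell1"
  shows "J b \<in> dual"
proof (rule dualI)
  fix x y c
  have "J b (x + y) = (\<Sum>\<^sub>\<infinity>\<gamma>\<in>\<Gamma>. b \<gamma> * \<gamma> x + b \<gamma> * \<gamma> y)"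
    unfolding J_def by (intro infsum_cong) (simp add: dual_add \<Gamma>_dual distrib_left)
  then show "J b (x + y) = J b x + J b y"
    using infsum_add[OF J_summable[OF b] J_summable[OF b]] by (simp add: J_def)
  have "J b (smul c x) = (\<Sum>\<^sub>\<infinity>\<gamma>\<in>\<Gamma>. c * (b \<gamma> * \<gamma> x))"
    unfolding J_def by (intro infsum_cong) (simp add: dual_scale \<Gamma>_dual mult_ac)
  then show "J b (smul c x) = c * J b x" by (simp add: J_def infsum_cmult_right')
  show "norm (J b x) \<le> (\<Sum>\<^sub>\<infinity>\<gamma>\<in>\<Gamma>. norm (b \<gamma>)) * norm x"
    unfolding J_def by (rule J_abs_summable(3)[OF b order_refl])
qed

lemma S_uniform_sum:
  assumes "finite F" "F \<subseteq> \<Gamma>"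
  shows "integrable M (\<lambda>m. \<Sum>\<gamma>\<in>F. b \<gamma> * uniform (rep \<gamma>) m)"
    and "S (\<lambda>m. \<Sum>\<gamma>\<in>F. b \<gamma> * uniform (rep \<gamma>) m) = (\<lambda>x. \<Sum>\<gamma>\<in>F. b \<gamma> * \<gamma> x)"
    and "\<gamma>' \<in> F \<Longrightarrow> coef (rep \<gamma>') (\<lambda>m. \<Sum>\<gamma>\<in>F. b \<gamma> * uniform (rep \<gamma>) m) = b \<gamma>'"
proof -
  have ui: "integrable M (\<lambda>m. b \<gamma> * uniform (rep \<gamma>) m)" if "\<gamma> \<in> \<Gamma>" for \<gamma>
    using that by (intro integrable_mult_right uniform_integrable rep(1))
  show int: "integrable M (\<lambda>m. \<Sum>\<gamma>\<in>F. b \<gamma> * uniform (rep \<gamma>) m)"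
    using assms ui by (intro Bochner_Integration.integrable_sum) auto
  show "S (\<lambda>m. \<Sum>\<gamma>\<in>F. b \<gamma> * uniform (rep \<gamma>) m) = (\<lambda>x. \<Sum>\<gamma>\<in>F. b \<gamma> * \<gamma> x)"
    using assms
  proof (induction F)
    case empty
    show ?case using S_scale[of "\<lambda>m. 0" 0] by simp
  next
    case (insert \<gamma> F)
    have "integrable M (\<lambda>m. \<Sum>\<gamma>\<in>F. b \<gamma> * uniform (rep \<gamma>) m)"
      using insert ui by (intro Bochner_Integration.integrable_sum) auto
    then show ?case
      using insert ui[of \<gamma>] S_scale[OF uniform_integrable[OF rep(1)], of \<gamma> "b \<gamma>"]
      by (simp add: S_add rep(2))
  qed
  assume g: "\<gamma>' \<in> F"
  then have "rep \<gamma>' \<in> sets M" using assms rep(1) by (auto simp: atom_def)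
  then have "integrable M (\<lambda>m. indicator (rep \<gamma>') m *\<^sub>R (b \<gamma> * uniform (rep \<gamma>) m))" if "\<gamma> \<in> F" for \<gamma>
    using that assms by (intro integrable_mult_indicator ui) auto
  then have "coef (rep \<gamma>') (\<lambda>m. \<Sum>\<gamma>\<in>F. b \<gamma> * uniform (rep \<gamma>) m)
      = (\<Sum>\<gamma>\<in>F. coef (rep \<gamma>') (\<lambda>m. b \<gamma> * uniform (rep \<gamma>) m))"
    unfolding coef_def scaleR_sum_right by (rule Bochner_Integration.integral_sum)
  also have "\<dots> = (\<Sum>\<gamma>\<in>F. b \<gamma> * coef (rep \<gamma>') (uniform (rep \<gamma>)))"
    by (simp add: coef_mult)
  also have "\<dots> = (\<Sum>\<gamma>\<in>F. if \<gamma> = \<gamma>' then b \<gamma>' else 0)"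
    using assms g by (intro sum.cong) (auto simp: coef_uniform subset_iff)
  also have "\<dots> = b \<gamma>'" using assms g by (simp add: sum.delta)
  finally show "coef (rep \<gamma>') (\<lambda>m. \<Sum>\<gamma>\<in>F. b \<gamma> * uniform (rep \<gamma>) m) = b \<gamma>'" .
qed

text \<open>Cutting \<open>b\<close> down to a finite set changes the functional by at most the tail
  of the series. As \<open>coef\<close> is bounded by \<open>nrm\<close>, the biorthogonality of
  finite sums passes to the limit.\<close>

lemma coef_J:
  assumes b: "b \<in> ell1" and f: "integrable M f" "S f = J b" and g: "\<gamma> \<in> \<Gamma>"
  shows "coef (rep \<gamma>) f = b \<gamma>"
proof -
  have le: "norm (coef (rep \<gamma>) f - b \<gamma>) \<le> 0 + e" if e: "e > 0" for e
  proof -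
    have sb: "(\<lambda>\<delta>. norm (b \<delta>)) summable_on \<Gamma>" using b by (simp add: ell1_iff)
    obtain F0 where F0: "finite F0" "F0 \<subseteq> \<Gamma>" "dist (\<Sum>\<delta>\<in>F0. norm (b \<delta>)) (\<Sum>\<^sub>\<infinity>\<delta>\<in>\<Gamma>. norm (b \<delta>)) \<le> e"
      using infsum_finite_approximation[OF sb e] by blast
    \<comment> \<open>With \<open>\<gamma>\<close> in the finite set, the coefficient of the finite
      sum at \<open>\<gamma>\<close> is exactly \<open>b \<gamma>\<close>.\<close>
    define F where "F = insert \<gamma> F0"
    have F: "finite F" "F \<subseteq> \<Gamma>" "\<gamma> \<in> F" using F0 g by (auto simp: F_def)
    have split: "infsum h \<Gamma> = sum h F + infsum h (\<Gamma> - F)"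
      if "h summable_on (\<Gamma> - F)" for h :: "('a \<Rightarrow> 'k) \<Rightarrow> 'c::{topological_comm_monoid_add, t2_space}"
      using infsum_Un_disjoint[of h F "\<Gamma> - F"] F that by (simp add: Un_absorb1)
    have "(\<Sum>\<delta>\<in>F0. norm (b \<delta>)) \<le> (\<Sum>\<delta>\<in>F. norm (b \<delta>))"
      using F by (intro sum_mono2) (auto simp: F_def)
    then have tail: "(\<Sum>\<^sub>\<infinity>\<delta>\<in>\<Gamma> - F. norm (b \<delta>)) \<le> e"
      using F0(3) split[OF J_abs_summable(2)[OF b Diff_subset]] by (simp add: dist_real_def)
    let ?g = "\<lambda>m. \<Sum>\<delta>\<in>F. b \<delta> * uniform (rep \<delta>) m"
    note gi = S_uniform_sum(1)[OF F(1,2), of b] and Sg = S_uniform_sum(2)[OF F(1,2), of b]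
    have "r (\<lambda>m. f m - ?g m) x \<le> e * norm x" for x
    proof -
      have "J b x = (\<Sum>\<delta>\<in>F. b \<delta> * \<delta> x) + (\<Sum>\<^sub>\<infinity>\<delta>\<in>\<Gamma> - F. b \<delta> * \<delta> x)"
        unfolding J_def by (rule split[OF Infinite_Sum.abs_summable_summable[OF J_abs_summable(1)[OF b Diff_subset]]])
      then have "S f x = S ?g x + (\<Sum>\<^sub>\<infinity>\<delta>\<in>\<Gamma> - F. b \<delta> * \<delta> x)" by (simp add: f(2) Sg)
      then have "r f x = r ?g x + re (\<Sum>\<^sub>\<infinity>\<delta>\<in>\<Gamma> - F. b \<delta> * \<delta> x)" by (simp add: r_def re_add)
      moreover have "re (\<Sum>\<^sub>\<infinity>\<delta>\<in>\<Gamma> - F. b \<delta> * \<delta> x) \<le> (\<Sum>\<^sub>\<infinity>\<delta>\<in>\<Gamma> - F. norm (b \<delta>)) * norm x"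
        using re_le J_abs_summable(3)[OF b Diff_subset] by (rule order_trans)
      moreover have "(\<Sum>\<^sub>\<infinity>\<delta>\<in>\<Gamma> - F. norm (b \<delta>)) * norm x \<le> e * norm x"
        using tail by (intro mult_right_mono) auto
      ultimately show ?thesis by (simp add: r_diff[OF f(1) gi])
    qed
    then have near: "nrm (\<lambda>m. f m - ?g m) \<le> e"
      by (rule r_norming[OF Bochner_Integration.integrable_diff[OF f(1) gi] less_imp_le[OF e]])
    have C: "rep \<gamma> \<in> sets M" using rep(1)[OF g] by (simp add: atom_def)
    have "coef (rep \<gamma>) f - b \<gamma> = coef (rep \<gamma>) (\<lambda>m. f m - ?g m)"
      unfolding coef_diff[OF C f(1) gi] S_uniform_sum(3)[OF F, of b] ..
    then show ?thesis
      using order_trans[OF coef_norm_le_nrm[OF C Bochner_Integration.integrable_diff[OF f(1) gi]] near] by (simp only: add_0)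
  qed
  have "norm (coef (rep \<gamma>) f - b \<gamma>) \<le> 0" by (rule field_le_epsilon[OF le])
  then show ?thesis by simp
qed

text \<open>For the lower bound, any function representing \<open>J b\<close> has the coefficients
  \<open>b\<close>, and their finite sums are bounded by its norm.\<close>

lemma J_norm:
  assumes b: "b \<in> ell1"
  shows "onorm (J b) = (\<Sum>\<^sub>\<infinity>\<gamma>\<in>\<Gamma>. norm (b \<gamma>))"
proof (rule antisym)
  show "onorm (J b) \<le> (\<Sum>\<^sub>\<infinity>\<gamma>\<in>\<Gamma>. norm (b \<gamma>))"
    using J_abs_summable(3)[OF b order_refl] by (intro onorm_bound infsum_nonneg) (auto simp: J_def)
  obtain f where f: "integrable M f" "S f = J b" using S_surj[OF J_dual[OF b]] by blast
  show "(\<Sum>\<^sub>\<infinity>\<gamma>\<in>\<Gamma>. norm (b \<gamma>)) \<le> onorm (J b)"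
  proof (rule infsum_le_finite_sums)
    fix F assume F: "finite F" "F \<subseteq> \<Gamma>"
    have "(\<Sum>\<gamma>\<in>F. norm (b \<gamma>)) = (\<Sum>\<gamma>\<in>F. norm (coef (rep \<gamma>) f))"
      using F coef_J[OF b f] by (intro sum.cong) auto
    also have "\<dots> \<le> onorm (J b)" using sum_coef_le[OF F f(1)] S_norm[OF f(1)] f(2) by simp
    finally show "(\<Sum>\<gamma>\<in>F. norm (b \<gamma>)) \<le> onorm (J b)" .
  qed (use b in \<open>simp add: ell1_iff\<close>)
qed

lemma J_inj: "inj_on J ell1"
proof (rule inj_onI)
  fix b c assume bc: "b \<in> ell1" "c \<in> ell1" "J b = J c"
  obtain f where f: "integrable M f" "S f = J b" using S_surj[OF J_dual[OF bc(1)]] by blast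
  have "b \<gamma> = c \<gamma>" for \<gamma>
    using coef_J[OF bc(1) f, of \<gamma>] coef_J[OF bc(2) f(1), of \<gamma>] f(2) bc by (cases "\<gamma> \<in> \<Gamma>") (auto simp: ell1_iff)
  then show "b = c" by blast
qed

text \<open>On an atom the set where \<open>h m \<bullet> b\<close> is positive is null or of full
  measure. Full measure would contradict the vanishing integral; using \<open>b\<close> and
  \<open>- b\<close> for every basis vector kills all coordinates.\<close>

lemma atom_orthogonal_imp_zero:
  assumes C: "atom C" and h: "integrable M h" "coef C h = 0"
  shows "AE m in M. m \<in> C \<longrightarrow> h m = 0"
proof -
  note [measurable] = borel_measurable_integrable[OF h(1)]
  have C_sets[measurable]: "C \<in> sets M" and fin: "emeasure M C < \<infinity>" and pos: "0 < measure M C"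
    and dich: "\<And>D. D \<in> sets M \<Longrightarrow> D \<subseteq> C \<Longrightarrow> measure M D = 0 \<or> measure M D = measure M C"
    using C by (auto simp: atom_def)
  have le: "AE m in M. m \<in> C \<longrightarrow> h m \<bullet> b \<le> 0" for b
  proof -
    define D where "D = {m\<in>C. h m \<bullet> b > 0}"
    have "D = C \<inter> {m\<in>space M. h m \<bullet> b > 0}" using sets.sets_into_space[OF C_sets] by (auto simp: D_def)
    moreover have "{m\<in>space M. h m \<bullet> b > 0} \<in> sets M" by measurable
    ultimately have D_sets[measurable]: "D \<in> sets M" by simp
    have "measure M D = 0"
    proof (rule ccontr)
      assume "measure M D \<noteq> 0"
      with dich[of D] have "measure M D = measure M C" by (auto simp: D_def)
      then have "measure M (C - D) = 0" using fin by (subst measure_Diff) (auto simp: D_def)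
      then have "C - D \<in> null_sets M"
        using fin by (intro finite_measure_zero_null[OF C_sets]) auto
      then have notin: "AE m in M. m \<notin> C - D" by (rule AE_not_in)
      let ?k = "\<lambda>m. (indicator C m *\<^sub>R h m) \<bullet> b"
      have hi: "integrable M (\<lambda>m. indicator C m *\<^sub>R h m)" by (rule integrable_mult_indicator[OF C_sets h(1)])
      have ki: "integrable M ?k" using hi by (rule integrable_inner_left)
      have "(\<integral>m. ?k m \<partial>M) = coef C h \<bullet> b" unfolding coef_def using hi by (intro integral_inner_left) auto
      then have "(\<integral>m. ?k m \<partial>M) = 0" using h(2) by simp
      moreover have "AE m in M. 0 \<le> ?k m"
        using notin by eventually_elim (auto simp: D_def split: split_indicator)
      ultimately have "AE m in M. ?k m = 0" using integral_nonneg_eq_0_iff_AE[OF ki] by blast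
      then have "AE m in M. m \<notin> D" by eventually_elim (auto simp: D_def split: split_indicator)
      then have "D \<in> null_sets M" using D_sets by (simp add: AE_iff_null_sets)
      with \<open>measure M D \<noteq> 0\<close> show False by (auto simp: measure_def null_sets_def)
    qed
    then have "D \<in> null_sets M"
      using fin by (intro finite_measure_zero_null[OF C_sets]) (auto simp: D_def)
    then have "AE m in M. m \<notin> D" by (rule AE_not_in)
    then show ?thesis by eventually_elim (auto simp: D_def)
  qed
  have "AE m in M. \<forall>b\<in>Basis. m \<in> C \<longrightarrow> h m \<bullet> b = 0"
  proof (rule AE_finite_allI)
    fix b :: 'k
    show "AE m in M. m \<in> C \<longrightarrow> h m \<bullet> b = 0"
      using le[of b] le[of "- b"] by eventually_elim (auto simp: inner_minus_right)
  qed simp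
  then show ?thesis by eventually_elim (auto intro: euclidean_eqI)
qed

text \<open>\<open>rep\<close> may select another atom for the same functional, but equal
  functionals have uniform densities that agree almost everywhere, and hence the atoms do.\<close>

lemma coef_rep:
  assumes C: "atom C" and h: "integrable M h"
  shows "coef C h = coef (rep (S (uniform C))) h"
proof -
  let ?D = "rep (S (uniform C))"
  have g: "S (uniform C) \<in> \<Gamma>" using C by (auto simp: \<Gamma>_def)
  note D = rep[OF g]
  have "AE m in M. uniform C m = uniform ?D m"
    using S_inj[OF uniform_integrable[OF C] uniform_integrable[OF D(1)]] D(2) by simp
  then have "AE m in M. indicator C m *\<^sub>R h m = indicator ?D m *\<^sub>R h m"
  proof eventually_elim
    case (elim m)
    then have "(m \<in> C) = (m \<in> ?D)"
      using C D(1) by (auto simp: uniform_def atom_def split: split_indicator_asm)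
    then show ?case by (simp add: indicator_def)
  qed
  moreover have "C \<in> sets M" "?D \<in> sets M" using C D by (auto simp: atom_def)
  ultimately show ?thesis unfolding coef_def
    using borel_measurable_integrable[OF h] by (intro integral_cong_AE) auto
qed

text \<open>Let \<open>g\<close> represent the functional with the coefficients of \<open>f\<close>.
  Then \<open>h = f - g\<close> vanishes on every atom. The sets where \<open>norm (h m)\<close> is
  at least \<open>1 / real (Suc n)\<close> have finite measure by Markov's inequality; one of
  positive measure would contain an atom, on which \<open>h\<close> is nonzero.\<close>

lemma J_surj:
  assumes ssd: "\<And>x :: 'a. norm x = 1 \<Longrightarrow> SSD_at x" and F: "F \<in> dual"
  shows "\<exists>b\<in>ell1. J b = F"
proof -
  obtain f where f: "integrable M f" "S f = F" using S_surj[OF F] by blast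
  define b where "b \<gamma> = (if \<gamma> \<in> \<Gamma> then coef (rep \<gamma>) f else 0)" for \<gamma>
  have "(\<lambda>\<gamma>. norm (b \<gamma>)) summable_on \<Gamma>"
  proof (rule nonneg_bdd_above_summable_on)
    have "(\<Sum>\<gamma>\<in>G. norm (b \<gamma>)) \<le> nrm f" if "finite G" "G \<subseteq> \<Gamma>" for G
    proof -
      have "(\<Sum>\<gamma>\<in>G. norm (b \<gamma>)) = (\<Sum>\<gamma>\<in>G. norm (coef (rep \<gamma>) f))"
        using that by (intro sum.cong) (auto simp: b_def)
      then show ?thesis using sum_coef_le[OF that f(1)] by simp
    qed
    then show "bdd_above (sum (\<lambda>\<gamma>. norm (b \<gamma>)) ` {G. G \<subseteq> \<Gamma> \<and> finite G})"
      by (intro bdd_aboveI2) auto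
  qed simp
  then have b: "b \<in> ell1" by (simp add: ell1_iff b_def)
  obtain g where g: "integrable M g" "S g = J b" using S_surj[OF J_dual[OF b]] by blast
  define h where "h m = f m - g m" for m
  have h: "integrable M h" unfolding h_def[abs_def] using f g by simp
  note [measurable] = borel_measurable_integrable[OF h]
  have coef_h: "coef C h = 0" if C: "atom C" for C
  proof -
    have g': "S (uniform C) \<in> \<Gamma>" using C by (auto simp: \<Gamma>_def)
    then have "rep (S (uniform C)) \<in> sets M" using rep(1) by (auto simp: atom_def)
    then have "coef (rep (S (uniform C))) h = 0"
      using coef_J[OF b g g'] g' f g by (simp add: h_def[abs_def] coef_diff b_def)
    then show ?thesis using coef_rep[OF C h] by simp
  qed
  have null: "AE m in M. norm (h m) < 1 / real (Suc n)" for n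
  proof (rule ccontr)
    assume nAE: "\<not> ?thesis"
    define A where "A = {m\<in>space M. 1 / real (Suc n) \<le> norm (h m)}"
    have A[measurable]: "A \<in> sets M" unfolding A_def by measurable
    have "emeasure M A \<le> (1 / (1 / real (Suc n))) * nrm h"
      unfolding A_def using h by (intro integral_Markov_inequality) auto
    also have "\<dots> < \<infinity>" by simp
    finally have A_fin: "emeasure M A < \<infinity>" .
    have "A \<notin> null_sets M"
    proof
      assume "A \<in> null_sets M"
      then have "AE m in M. m \<notin> A" by (rule AE_not_in)
      then have "AE m in M. norm (h m) < 1 / real (Suc n)" using AE_space
        by eventually_elim (auto simp: A_def)
      with nAE show False by simp
    qed
    then have "measure M A > 0"
      using finite_measure_zero_null[OF A A_fin A order_refl] by (auto simp: zero_less_measure_iff)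
    from SSD_imp_atom[OF ssd A A_fin this] obtain C where C: "C \<in> sets M" "C \<subseteq> A" "0 < measure M C"
      "\<forall>D\<in>sets M. D \<subseteq> C \<longrightarrow> measure M D = 0 \<or> measure M D = measure M C" by blast
    have "emeasure M C < \<infinity>" using A_fin emeasure_mono[OF C(2) A] by auto
    then have C_atom: "atom C" using C by (simp add: atom_def)
    have "AE m in M. m \<in> C \<longrightarrow> h m = 0" by (rule atom_orthogonal_imp_zero[OF C_atom h coef_h[OF C_atom]])
    then have "AE m in M. m \<notin> C"
    proof eventually_elim
      case (elim m)
      have "norm (h m) > 0" if "m \<in> C"
      proof -
        have "1 / real (Suc n) \<le> norm (h m)" using that C(2) by (auto simp: A_def)
        moreover have "0 < 1 / real (Suc n)" by simp
        ultimately show ?thesis by linarith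
      qed
      with elim show ?case by auto
    qed
    then have "C \<in> null_sets M" using C(1) by (simp add: AE_iff_null_sets)
    with C(3) show False by (auto simp: measure_def null_sets_def)
  qed
  have "AE m in M. \<forall>n. norm (h m) < 1 / real (Suc n)" using null by (simp add: AE_all_countable)
  then have "AE m in M. f m = g m"
  proof eventually_elim
    case (elim m)
    have "\<not> norm (h m) > 0" using elim nat_approx_posE by (metis less_asym)
    then show ?case by (simp add: h_def)
  qed
  then have "S f = S g" by (intro S_cong_AE f g)
  with f g b show ?thesis by auto
qed

section \<open>Infinitude of \<open>\<Gamma>\<close> and the final isometry\<close>

text \<open>If \<open>g0\<close> is nonzero at some \<open>z\<close> in the common kernel of
  \<open>G\<close>, adding a multiple of \<open>z\<close> corrects the value of \<open>g0\<close>
  without disturbing \<open>G\<close>. Otherwise agreement on \<open>G\<close> already implies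
  agreement at \<open>g0\<close>.\<close>

lemma finite_functionals_span:
  assumes "finite G" "G \<subseteq> dual"
  shows "\<exists>B. finite B \<and> (\<forall>x. \<exists>y\<in>span B. \<forall>g\<in>G. g y = g x)"
  using assms
proof (induction G)
  case empty
  have "0 \<in> span {}" by simp
  then show ?case by (intro exI[of _ "{}"]) auto
next
  case (insert g0 G)
  then obtain B where B: "finite B" "\<And>x. \<exists>y\<in>span B. \<forall>g\<in>G. g y = g x" by auto
  have g0: "g0 \<in> dual" and G: "\<And>g. g \<in> G \<Longrightarrow> g \<in> dual" using insert by auto
  have dual_diff: "g (x - y) = g x - g y" if "g \<in> dual" for g x y
    using dual_add[OF that, of "x - y" y] by simp
  show ?case
  proof (cases "\<exists>z. (\<forall>g\<in>G. g z = 0) \<and> g0 z \<noteq> 0")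
    case True
    then obtain z where z: "\<forall>g\<in>G. g z = 0" "g0 z \<noteq> 0" by blast
    have "\<exists>y\<in>span (insert z B). \<forall>g\<in>insert g0 G. g y = g x" for x
    proof -
      obtain y where y: "y \<in> span B" "\<forall>g\<in>G. g y = g x" using B by blast
      let ?y = "y + smul ((g0 x - g0 y) / g0 z) z"
      have "?y \<in> span (insert z B)"
        by (intro span_add span_scale subsetD[OF span_mono[OF subset_insertI] y(1)]) (simp add: span_base)
      moreover have "\<forall>g\<in>insert g0 G. g ?y = g x"
        using y(2) z g0 G by (auto simp: dual_add dual_scale)
      ultimately show ?thesis by blast
    qed
    with B(1) show ?thesis by (intro exI[of _ "insert z B"]) auto
  next
    case False
    have "\<exists>y\<in>span B. \<forall>g\<in>insert g0 G. g y = g x" for x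
    proof -
      obtain y where y: "y \<in> span B" "\<forall>g\<in>G. g y = g x" using B by blast
      then have "\<forall>g\<in>G. g (y - x) = 0" using G by (simp add: dual_diff)
      with False have "g0 (y - x) = 0" by blast
      then have "g0 y = g0 x" by (simp add: dual_diff[OF g0])
      with y show ?thesis by blast
    qed
    with B(1) show ?thesis by blast
  qed
qed

text \<open>A vector killed by \<open>\<Gamma>\<close> is killed by every \<open>J b\<close>, hence
  by the whole dual, and so is 0. If \<open>\<Gamma>\<close> were finite, finitely many vectors
  would realise all values on \<open>\<Gamma>\<close> and therefore span.\<close>

lemma infinite_\<Gamma>:
  assumes ssd: "\<And>x :: 'a. norm x = 1 \<Longrightarrow> SSD_at x" and inf: "infinite_dimensional smul"
  shows "infinite \<Gamma>"
proof
  assume "finite \<Gamma>"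
  then obtain B where B: "finite B" "\<And>x. \<exists>y\<in>span B. \<forall>g\<in>\<Gamma>. g y = g x"
    using finite_functionals_span[of \<Gamma>] \<Gamma>_dual by blast
  have "x \<in> span B" for x
  proof -
    obtain y where y: "y \<in> span B" "\<forall>g\<in>\<Gamma>. g y = g x" using B by blast
    define z where "z = y - x"
    have z: "g z = 0" if "g \<in> \<Gamma>" for g
    proof -
      have "g y = g z + g x" using dual_add[OF \<Gamma>_dual[OF that], of z x] by (simp add: z_def)
      moreover have "g y = g x" using y(2) that by blast
      ultimately show ?thesis by simp
    qed
    \<comment> \<open>The zero functional satisfies the hypothesis of
      \<open>norming_functional_near\<close> with \<open>e = 1\<close>, which then yields a norming
      functional at \<open>z\<close>.\<close>
    have "(0::real) \<le> norm (z + w) - norm z + 1 * norm w" for w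
      using norm_triangle_ineq4[of "z + w" w] by simp
    from norming_functional_near[OF linear_zero _ this] obtain l where
      l: "linear l" "l z = norm z" "\<And>w. l w \<le> norm w" by auto
    obtain F where F: "F \<in> dual" "\<forall>w. re (F w) = l w" using ex_dual_of_real_functional[OF l(1,3)] by blast
    obtain b where "b \<in> ell1" "J b = F" using J_surj[OF ssd F(1)] by blast
    then have "F z = (\<Sum>\<^sub>\<infinity>\<gamma>\<in>\<Gamma>. b \<gamma> * \<gamma> z)" by (auto simp: J_def)
    also have "\<dots> = 0" using z by (intro infsum_0) simp
    finally have "norm z = 0" using F(2)[rule_format, of z] l(2) re_of_real[of 0] by simp
    then show ?thesis using y(1) by (simp add: z_def)
  qed
  then have "span B = UNIV" by blast
  with B(1) inf show False by (auto simp: infinite_dimensional_def)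
qed

lemma dual_isometric_ell1:
  assumes ssd: "\<And>x :: 'a. norm x = 1 \<Longrightarrow> SSD_at x"
  shows "linearly_isometric (dual_space smul) (ell1_space \<Gamma>)"
proof -
  have bij: "bij_betw J ell1 dual"
    using J_inj J_dual J_surj[OF ssd] by (auto simp: bij_betw_def)
  define R where "R = inv_into ell1 J"
  have R: "R F \<in> ell1" "J (R F) = F" if "F \<in> dual" for F
    using bij_betw_inv_into_right[OF bij that] inv_into_into[of F J ell1] that bij_betw_imp_surj_on[OF bij]
    by (simp_all add: R_def)
  have R_eqI: "R F = b" if "b \<in> ell1" "J b = F" for F b
    using that J_inj by (auto simp: R_def)
  show ?thesis
    unfolding linearly_isometric_def
  proof (intro exI[of _ R] conjI ballI allI)
    show "bij_betw R dual ell1" unfolding R_def by (rule bij_betw_inv_into[OF bij])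
  next
    fix u v assume uv: "u \<in> dual" "v \<in> dual"
    have "(\<lambda>i. R u i + R v i) \<in> ell1"
      using R(1)[OF uv(1)] R(1)[OF uv(2)]
        Infinite_Sum.abs_summable_on_comparison_test'[OF summable_on_add norm_triangle_ineq, of "R u" \<Gamma> "R v"]
      by (simp add: ell1_iff)
    moreover have "J (\<lambda>i. R u i + R v i) = (\<lambda>x. u x + v x)"
    proof
      fix x
      have "J (\<lambda>i. R u i + R v i) x = J (R u) x + J (R v) x"
        unfolding J_def distrib_right by (rule infsum_add[OF J_summable[OF R(1)[OF uv(1)]] J_summable[OF R(1)[OF uv(2)]]])
      then show "J (\<lambda>i. R u i + R v i) x = u x + v x" using R(2) uv by simp
    qed
    ultimately have "R (\<lambda>x. u x + v x) = (\<lambda>i. R u i + R v i)" by (rule R_eqI)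
    then show "R (vadd (dual_space smul) u v) = vadd (ell1_space \<Gamma>) (R u) (R v)"
      by (simp add: dual_space_def ell1_space_def)
  next
    fix c v assume v: "v \<in> dual"
    have "(\<lambda>i. c * R v i) \<in> ell1"
      using R(1)[OF v] by (auto simp: ell1_iff norm_mult intro: summable_on_cmult_right)
    moreover have "J (\<lambda>i. c * R v i) = (\<lambda>x. c * v x)"
    proof
      fix x
      have "J (\<lambda>i. c * R v i) x = c * J (R v) x"
        unfolding J_def mult.assoc by (rule infsum_cmult_right')
      then show "J (\<lambda>i. c * R v i) x = c * v x" using R(2)[OF v] by simp
    qed
    ultimately have "R (\<lambda>x. c * v x) = (\<lambda>i. c * R v i)" by (rule R_eqI)
    then show "R (vscale (dual_space smul) c v) = vscale (ell1_space \<Gamma>) c (R v)"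
      by (simp add: dual_space_def ell1_space_def)
  next
    fix v assume v: "v \<in> dual"
    show "vnorm (ell1_space \<Gamma>) (R v) = vnorm (dual_space smul) v"
      using J_norm[OF R(1)[OF v]] R(2)[OF v] by (simp add: dual_space_def ell1_space_def)
  qed
qed

end

lemma predual_SSD_imp_ell1:
  fixes smul :: "'k::{real_normed_field, euclidean_space} \<Rightarrow> 'a::banach \<Rightarrow> 'a"
  assumes predual: "L1_predual smul M" and inf: "infinite_dimensional smul"
    and ssd: "\<forall>x::'a. norm x = 1 \<longrightarrow> SSD_at x"
    and re: "\<And>a b. re (a + b) = re a + re b" "\<And>t a. re (of_real t * a) = t * re a"
      "\<And>a. re a \<le> norm a" "\<And>t. re (of_real t) = t"
    and extend: "\<And>l :: 'a \<Rightarrow> real. \<lbrakk>linear l; \<And>y. l y \<le> norm y\<rbrakk> \<Longrightarrow>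
      \<exists>F. Vector_Spaces.linear smul (*) F \<and> (\<forall>x. re (F x) = l x)"
  shows "\<exists>\<Gamma> :: ('a \<Rightarrow> 'k) set. infinite \<Gamma> \<and> linearly_isometric (dual_space smul) (ell1_space \<Gamma>)"
proof -
  interpret normed_space_over smul using predual by (simp add: L1_predual_def)
  obtain T where "bij_betw T (vecs (dual_space smul)) (vecs (L1_space M))"
    "\<forall>u\<in>vecs (dual_space smul). \<forall>v\<in>vecs (dual_space smul).
      T (vadd (dual_space smul) u v) = vadd (L1_space M) (T u) (T v)"
    "\<forall>c. \<forall>v\<in>vecs (dual_space smul). T (vscale (dual_space smul) c v) = vscale (L1_space M) c (T v)"
    "\<forall>v\<in>vecs (dual_space smul). vnorm (L1_space M) (T v) = vnorm (dual_space smul) v"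
    using predual by (auto simp: L1_predual_def linearly_isometric_def)
  then interpret predual_of_L1 smul M re T
    by unfold_locales (use re extend in auto)
  show ?thesis using infinite_\<Gamma>[OF _ inf] dual_isometric_ell1 ssd by blast
qed

theorem theorem6:
  fixes M :: "'m measure"
  shows
    "(infinite_dimensional (scaleR :: real \<Rightarrow> 'a::banach \<Rightarrow> 'a) \<and>
      L1_predual (scaleR :: real \<Rightarrow> 'a \<Rightarrow> 'a) M \<and>
      (\<forall>x::'a. norm x = 1 \<longrightarrow> SSD_at x) \<longrightarrow>
      (\<exists>\<Gamma> :: ('a \<Rightarrow> real) set. infinite \<Gamma> \<and>
         linearly_isometric (dual_space (scaleR :: real \<Rightarrow> 'a \<Rightarrow> 'a)) (ell1_space \<Gamma>)))
     \<and>
     (\<forall>smul :: complex \<Rightarrow> 'a \<Rightarrow> 'a.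
      infinite_dimensional smul \<and>
      L1_predual smul M \<and>
      (\<forall>x::'a. norm x = 1 \<longrightarrow> SSD_at x) \<longrightarrow>
      (\<exists>\<Gamma> :: ('a \<Rightarrow> complex) set. infinite \<Gamma> \<and>
         linearly_isometric (dual_space smul) (ell1_space \<Gamma>)))"
proof (intro conjI allI impI; elim conjE)
  assume hyp: "infinite_dimensional (scaleR :: real \<Rightarrow> 'a \<Rightarrow> 'a)"
    "L1_predual (scaleR :: real \<Rightarrow> 'a \<Rightarrow> 'a) M" "\<forall>x::'a. norm x = 1 \<longrightarrow> SSD_at x"
  show "\<exists>\<Gamma> :: ('a \<Rightarrow> real) set. infinite \<Gamma> \<and>
      linearly_isometric (dual_space (scaleR :: real \<Rightarrow> 'a \<Rightarrow> 'a)) (ell1_space \<Gamma>)"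
  proof (rule predual_SSD_imp_ell1[OF hyp(2,1,3), where re = "\<lambda>a. a"])
    fix l :: "'a \<Rightarrow> real" assume l: "linear l"
    have "Vector_Spaces.linear (scaleR :: real \<Rightarrow> 'a \<Rightarrow> 'a) (*) l"
      using normed_space_over.axioms(1)[OF normed_space_over_scaleR]
        normed_space_over.axioms(1)[OF normed_space_over_mult]
      by (simp add: Vector_Spaces.linear_iff linear_add[OF l] linear_scale[OF l])
    then show "\<exists>F. Vector_Spaces.linear (scaleR :: real \<Rightarrow> 'a \<Rightarrow> 'a) (*) F \<and> (\<forall>x. F x = l x)"
      by blast
  qed auto
next
  fix smul :: "complex \<Rightarrow> 'a \<Rightarrow> 'a"
  assume hyp: "infinite_dimensional smul" "L1_predual smul M" "\<forall>x::'a. norm x = 1 \<longrightarrow> SSD_at x"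
  interpret normed_space_over smul using hyp(2) by (simp add: L1_predual_def)
  show "\<exists>\<Gamma> :: ('a \<Rightarrow> complex) set. infinite \<Gamma> \<and> linearly_isometric (dual_space smul) (ell1_space \<Gamma>)"
  proof (rule predual_SSD_imp_ell1[OF hyp(2,1,3), where re = Re])
    fix l :: "'a \<Rightarrow> real" assume l: "linear l"
    \<comment> \<open>The imaginary part is dictated by complex linearity: it has to be minus the
      real part of the value at \<open>smul \<i> x\<close>.\<close>
    define F where "F x = Complex (l x) (- l (smul \<i> x))" for x
    have F_add: "F (x + y) = F x + F y" for x y
      by (simp add: F_def linear_add[OF l] scale_right_distrib complex_eq_iff)
    have F_scale: "F (smul c x) = c * F x" for c x
    proof -
      have sc: "l (smul c y) = Re c * l y + Im c * l (smul \<i> y)" for c y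
      proof -
        have "smul c y = smul (of_real (Re c)) y + smul (of_real (Im c)) (smul \<i> y)"
          by (simp add: scale_left_distrib[symmetric] complex_eq_iff)
        then have "smul c y = Re c *\<^sub>R y + Im c *\<^sub>R smul \<i> y" by (simp only: scale_of_real)
        then show ?thesis by (simp add: linear_add[OF l] linear_scale[OF l])
      qed
      have "l (smul \<i> (smul c x)) = - Im c * l x + Re c * l (smul \<i> x)"
        using sc[of "\<i> * c" x] by simp
      then show ?thesis by (simp add: F_def complex_eq_iff sc[of c x])
    qed
    have "Vector_Spaces.linear smul (*) F"
      using normed_space_over.axioms(1)[OF normed_space_over_mult] vector_space_axioms
      by (simp add: Vector_Spaces.linear_iff F_add F_scale)
    then show "\<exists>F. Vector_Spaces.linear smul (*) F \<and> (\<forall>x. Re (F x) = l x)"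
      by (intro exI[of _ F]) (simp add: F_def)
  qed (auto simp: complex_Re_le_cmod)
qed

end
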